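(* Let $n\in\mathbb{N}$, let $\theta=(\theta_1,\ldots,\theta_n)\in\mathbb{R}^n$ be arbitrary, and let $j_1,\ldots,j_n>0$ with $\sum_{i=1}^n j_i=1$. Then $$\dim\Big(\mathrm{Bad}_{\theta}(j_1,\ldots,j_n)\cap\mathrm{Bad}(1,0,\ldots,0)\cap\mathrm{Bad}(0,1,0,\ldots,0)\cap\ldots\cap\mathrm{Bad}(0,\ldots,0,1)\Big)=n,$$ where $\dim$ denotes Hausdorff dimension.
   Context: For $x\in\mathbb{R}$, $\|x\|$ denotes the distance from $x$ to the nearest integer. For $\theta\in\mathbb{R}^n$ and weights $j_1,\ldots,j_n>0$ with $\sum_i j_i=1$, the twisted set is $$\mathrm{Bad}_{\theta}(j_1,\ldots,j_n)=\Big\{(\eta_1,\ldots,\eta_n)\in\mathbb{R}^n:\ \inf_{q\in\mathbb{N}}\max_{1\le i\le n}\big(q^{j_i}\|q\theta_i-\eta_i\|\big)>0\Big\}.$$ For $1\le i\le n$, $\mathrm{Bad}(0,\ldots,0,1,0,\ldots,0)$ (with the $1$ in the $i$-th position) denotes the set of points $(\eta_1,\ldots,\eta_n)\in\mathbb{R}^n$ whose $i$-th coordinate is badly approximable, i.e. $\inf_{q\in\mathbb{N}} q\|q\eta_i\|>0$. *)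

theory Defs
  imports "HOL-Analysis.Analysis"
begin

definition dist_int :: "real \<Rightarrow> real" where
  "dist_int x = infdist x \<int>"

text \<open>\<open>q\<close> ranges over the positive integers. All the infima below are of nonempty
  sets of nonnegative reals, so the conditionally complete \<open>INF\<close> on the reals is the true infimum.\<close>

definition twisted_bad :: "real ^ 'n \<Rightarrow> real ^ 'n \<Rightarrow> (real ^ 'n) set" where
  "twisted_bad \<theta> j =
    {\<eta>. (INF q\<in>{1::nat..}. MAX i. real q powr (j $ i) * dist_int (real q * \<theta> $ i - \<eta> $ i)) > 0}"

definition coord_bad :: "'n \<Rightarrow> (real ^ 'n) set" where
  "coord_bad i = {\<eta>. (INF q\<in>{1::nat..}. real q * dist_int (real q * \<eta> $ i)) > 0}"

text \<open>The cost of a covering set is \<open>diameter U\<close> to the power \<open>s\<close>, with the conventions that the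
  empty set costs \<open>0\<close> and that \<open>0\<close> to the power \<open>0\<close> is \<open>1\<close> (whereas \<open>0 powr 0 = 0\<close>).
  Covering sets are required to be bounded because \<open>diameter\<close> is real-valued and
  unspecified on unbounded sets. Finite covers are included, by padding with empty sets.\<close>

definition diam_power :: "real \<Rightarrow> 'a::metric_space set \<Rightarrow> real" where
  "diam_power s U = (if U = {} then 0 else if s = 0 then 1 else diameter U powr s)"

definition delta_covers :: "real \<Rightarrow> 'a::metric_space set \<Rightarrow> (nat \<Rightarrow> 'a set) set" where
  "delta_covers \<delta> A = {U. A \<subseteq> (\<Union>k. U k) \<and> (\<forall>k. bounded (U k) \<and> diameter (U k) \<le> \<delta>)}"

definition hausdorff_premeasure :: "real \<Rightarrow> real \<Rightarrow> 'a::metric_space set \<Rightarrow> ennreal" where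
  "hausdorff_premeasure s \<delta> A = (INF U\<in>delta_covers \<delta> A. \<Sum>k. ennreal (diam_power s (U k)))"

definition hausdorff_measure :: "real \<Rightarrow> 'a::metric_space set \<Rightarrow> ennreal" where
  "hausdorff_measure s A = (SUP \<delta>\<in>{0<..}. hausdorff_premeasure s \<delta> A)"

definition hausdorff_dim :: "'a::metric_space set \<Rightarrow> ennreal" where
  "hausdorff_dim A = (INF s\<in>{s. 0 \<le> s \<and> hausdorff_measure s A = 0}. ennreal s)"

end

theory Submission
  imports Defs
begin

text \<open>Upper bound: \<open>\<real>\<^sup>n\<close> has zero Hausdorff \<open>s\<close>-measure for \<open>s > n\<close>.

  Lower bound: if integer vectors \<open>u\<close> make \<open>u \<bullet> \<theta>\<close> very close to an integer while \<open>u \<bullet> \<eta>\<close>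
  stays \<open>\<delta>\<close>-far from the integers, then \<open>\<eta>\<close> is not close to \<open>q \<theta>\<close> modulo 1. Choosing the best such
  vector in each weighted box \<open>\<bar>u\<^sub>i\<bar> \<le> c 2\<^bsup>m L j\<^sub>i\<^esup>\<close>, only one new vector appears per level \<open>m\<close>. The unit
  cube is subdivided into cells of sides about \<open>2\<^bsup>-m L j\<^sub>i\<^esup>\<close>; in the rescaled cell the new vector
  excludes a few thin slabs, and for each coordinate at most one rational of the relevant height
  is near the cell, so at least half of the subcells survive. Given a cover of small
  \<open>s\<close>-cost with \<open>s < n\<close>, its members are treated as additional obstacles: an averaging argument
  finds a branch of surviving cells that avoids all of them, and the limit point lies in the
  set but not in the cover. Since \<open>L\<close> may be taken large depending on \<open>n - s\<close>, losing a factor 2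
  per level is harmless.\<close>

section \<open>Integers in intervals and progressions\<close>

lemma dist_int_le: "dist_int x \<le> \<bar>x - of_int p\<bar>"
  using infdist_le[of "of_int p" "\<int>" x] by (simp add: dist_int_def dist_real_def)

lemma dist_int_ge:
  assumes "\<And>p. \<delta> \<le> \<bar>x - of_int p\<bar>"
  shows "\<delta> \<le> dist_int x"
  unfolding dist_int_def infdist_def
  using assms by (auto simp: dist_real_def Ints_def intro!: cINF_greatest)

lemma dist_int_nonneg: "0 \<le> dist_int x"
  by (simp add: dist_int_def infdist_nonneg)

lemma dist_int_attained: obtains p where "dist_int x = \<bar>x - of_int p\<bar>"
proof -
  have "closed (\<int> :: real set)" by (rule closed_Ints)
  moreover have "(\<int> :: real set) \<noteq> {}" by auto
  ultimately obtain z where "z \<in> \<int>" "infdist x \<int> = dist x z"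
    using infdist_attains_inf by metis
  then show ?thesis using that by (auto simp: dist_int_def dist_real_def elim!: Ints_cases)
qed

lemma finite_int_interval:
  fixes x y :: real
  shows "finite {k::int. x \<le> of_int k \<and> of_int k \<le> y}"
proof (rule finite_subset)
  show "{k::int. x \<le> of_int k \<and> of_int k \<le> y} \<subseteq> {\<lceil>x\<rceil>..\<lfloor>y\<rfloor>}"
    by (auto simp: ceiling_le_iff le_floor_iff)
qed auto

lemma card_int_interval:
  assumes "A \<subseteq> {k::int. x \<le> of_int k \<and> of_int k \<le> y}" "x \<le> (y::real) + 1"
  shows "real (card A) \<le> y - x + 1"
proof -
  have "A \<subseteq> {\<lceil>x\<rceil>..\<lfloor>y\<rfloor>}" using assms by (auto simp: ceiling_le_iff le_floor_iff)
  then have "card A \<le> card {\<lceil>x\<rceil>..\<lfloor>y\<rfloor>}" by (intro card_mono) auto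
  then have "real (card A) \<le> real (nat (\<lfloor>y\<rfloor> - \<lceil>x\<rceil> + 1))"
    by (simp add: algebra_simps)
  also have "\<dots> \<le> y - x + 1"
  proof (cases "\<lfloor>y\<rfloor> - \<lceil>x\<rceil> + 1 \<ge> 0")
    case True
    then have "real (nat (\<lfloor>y\<rfloor> - \<lceil>x\<rceil> + 1)) = of_int \<lfloor>y\<rfloor> - of_int \<lceil>x\<rceil> + 1"
      by (simp add: of_nat_nat)
    then show ?thesis
      using of_int_floor_le[of y] le_of_int_ceiling[of x] by linarith
  next
    case False
    then show ?thesis using assms by simp
  qed
  finally show ?thesis .
qed

text \<open>The \<open>K\<close> terms sweep an interval of length at most
  \<open>K * \<bar>\<sigma>\<bar>\<close>; with the margin \<open>\<rho>\<close> on both sides,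
  where \<open>2 * \<rho> \<le> 1\<close>, at most \<open>K * \<bar>\<sigma>\<bar> + 2\<close>
  integers come into play. Consecutive terms are \<open>\<bar>\<sigma>\<bar>\<close> apart, so each
  integer is near at most \<open>2 * \<rho> / \<bar>\<sigma>\<bar> + 1\<close> of them.\<close>

lemma card_progression_near_integers:
  fixes \<sigma> \<beta> \<rho> :: real and k0 :: int and K :: nat
  assumes "\<sigma> \<noteq> 0" "0 \<le> \<rho>" "\<rho> \<le> 1/2"
  shows "real (card {k\<in>{k0..<k0 + int K}. \<exists>p::int. \<bar>\<beta> + of_int k * \<sigma> - of_int p\<bar> \<le> \<rho>})
           \<le> (real K * \<bar>\<sigma>\<bar> + 2) * (2 * \<rho> / \<bar>\<sigma>\<bar> + 1)"
proof -
  let ?I = "{k0..<k0 + int K}"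
  define near where "near p = {k\<in>?I. \<bar>\<beta> + of_int k * \<sigma> - of_int p\<bar> \<le> \<rho>}" for p :: int
  define P where "P = {p::int. \<exists>k\<in>?I. \<bar>\<beta> + of_int k * \<sigma> - of_int p\<bar> \<le> \<rho>}"
  \<comment> \<open>Left end of the swept interval: for negative \<open>\<sigma>\<close> the
    progression runs downwards.\<close>
  define lo where "lo = \<beta> + of_int k0 * \<sigma> - (if \<sigma> < 0 then real K * \<bar>\<sigma>\<bar> else 0)"
  have P_sub: "P \<subseteq> {p. lo - \<rho> \<le> of_int p \<and> of_int p \<le> lo + real K * \<bar>\<sigma>\<bar> + \<rho>}"
  proof
    fix p assume "p \<in> P"
    then obtain k where k: "k \<in> ?I" "\<bar>\<beta> + of_int k * \<sigma> - of_int p\<bar> \<le> \<rho>"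
      by (auto simp: P_def)
    define t where "t = real_of_int (k - k0)"
    have t: "0 \<le> t" "t \<le> real K" using k(1) by (auto simp: t_def)
    have eq: "\<beta> + of_int k * \<sigma> = \<beta> + of_int k0 * \<sigma> + t * \<sigma>"
      by (simp add: t_def algebra_simps)
    have ts: "0 \<le> t * \<bar>\<sigma>\<bar>" "t * \<bar>\<sigma>\<bar> \<le> real K * \<bar>\<sigma>\<bar>"
      using t by (auto intro: mult_right_mono)
    obtain s where s: "s = \<bar>\<sigma>\<bar>" by blast
    have "lo - \<rho> \<le> of_int p \<and> of_int p \<le> lo + real K * s + \<rho>"
    proof (cases "\<sigma> < 0")
      case True
      then have "t * \<sigma> = - (t * s)" "lo = \<beta> + of_int k0 * \<sigma> - real K * s" by (simp_all add: s lo_def)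
      then show ?thesis using k(2) ts unfolding eq s[symmetric] by linarith
    next
      case False
      then have "t * \<sigma> = t * s" "lo = \<beta> + of_int k0 * \<sigma>" by (simp_all add: s lo_def)
      then show ?thesis using k(2) ts unfolding eq s[symmetric] by linarith
    qed
    then show "p \<in> {p. lo - \<rho> \<le> of_int p \<and> of_int p \<le> lo + real K * \<bar>\<sigma>\<bar> + \<rho>}"
      by (simp add: s)
  qed
  have finP: "finite P" using P_sub finite_int_interval finite_subset by blast
  have "real (card P) \<le> (lo + real K * \<bar>\<sigma>\<bar> + \<rho>) - (lo - \<rho>) + 1"
    by (rule card_int_interval[OF P_sub]) (use assms in auto)
  then have cP: "real (card P) \<le> real K * \<bar>\<sigma>\<bar> + 2" using assms by linarith
  have cnear: "real (card (near p)) \<le> 2 * \<rho> / \<bar>\<sigma>\<bar> + 1" for p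
  proof -
    define z where "z = (of_int p - \<beta>) / \<sigma>"
    have "near p \<subseteq> {k. z - \<rho> / \<bar>\<sigma>\<bar> \<le> of_int k \<and> of_int k \<le> z + \<rho> / \<bar>\<sigma>\<bar>}"
    proof
      fix k assume "k \<in> near p"
      then have "\<bar>\<beta> + of_int k * \<sigma> - of_int p\<bar> \<le> \<rho>" by (simp add: near_def)
      moreover have "\<beta> + of_int k * \<sigma> - of_int p = (of_int k - z) * \<sigma>"
        using assms by (simp add: z_def field_simps)
      ultimately have "\<bar>of_int k - z\<bar> * \<bar>\<sigma>\<bar> \<le> \<rho>" by (simp add: abs_mult)
      then have "\<bar>of_int k - z\<bar> \<le> \<rho> / \<bar>\<sigma>\<bar>" using assms by (simp add: field_simps)
      then show "k \<in> {k. z - \<rho> / \<bar>\<sigma>\<bar> \<le> of_int k \<and> of_int k \<le> z + \<rho> / \<bar>\<sigma>\<bar>}"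
        by (simp add: abs_le_iff)
    qed
    then have "real (card (near p)) \<le> (z + \<rho> / \<bar>\<sigma>\<bar>) - (z - \<rho> / \<bar>\<sigma>\<bar>) + 1"
      by (rule card_int_interval) (use assms in \<open>simp add: add_nonneg_nonneg\<close>)
    then show ?thesis by (simp add: field_simps)
  qed
  have "{k\<in>?I. \<exists>p::int. \<bar>\<beta> + of_int k * \<sigma> - of_int p\<bar> \<le> \<rho>} = (\<Union>p\<in>P. near p)"
    unfolding P_def near_def by blast
  then have "real (card {k\<in>?I. \<exists>p::int. \<bar>\<beta> + of_int k * \<sigma> - of_int p\<bar> \<le> \<rho>})
      \<le> real (\<Sum>p\<in>P. card (near p))"
    using card_UN_le[OF finP, of near] by (simp only: of_nat_le_iff)
  also have "\<dots> \<le> (\<Sum>p\<in>P. 2 * \<rho> / \<bar>\<sigma>\<bar> + 1)"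
    using cnear by (simp only: of_nat_sum) (intro sum_mono, auto)
  also have "\<dots> = real (card P) * (2 * \<rho> / \<bar>\<sigma>\<bar> + 1)" by simp
  also have "\<dots> \<le> (real K * \<bar>\<sigma>\<bar> + 2) * (2 * \<rho> / \<bar>\<sigma>\<bar> + 1)"
    using cP assms by (intro mult_right_mono) auto
  finally show ?thesis .
qed

text \<open>Averaging over the lines parallel to direction \<open>l\<close>: a proportion valid on
  each line is valid on the whole product. This reduces counting in a box to counting along one
  progression.\<close>

lemma card_Pi_fibre_bound:
  fixes S :: "'n::finite \<Rightarrow> int set" and X :: "('n \<Rightarrow> int) set"
  assumes fin: "\<And>i. finite (S i)" and ne: "S l \<noteq> {}"
    and fibre: "\<And>b. b \<in> Pi UNIV S \<Longrightarrow> real (card {k\<in>S l. b(l := k) \<in> X}) \<le> \<kappa> * real (card (S l))"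
  shows "real (card (X \<inter> Pi UNIV S)) \<le> \<kappa> * real (card (Pi UNIV S))"
proof -
  define P where "P = Pi UNIV S"
  have finP: "finite P" using finite_PiE[of UNIV S] fin by (simp add: PiE_def P_def)
  have mem: "b(l := k) \<in> P" if "b \<in> P" "k \<in> S l" for b k
    using that by (simp add: Pi_iff P_def)
  have mem_l: "b l \<in> S l" if "b \<in> P" for b using that by (simp add: Pi_iff P_def)
  \<comment> \<open>Exchanging the entry at \<open>l\<close> with \<open>k\<close> is an involution;
    it turns pairs of a base point and a hit on its line into pairs of a hit and a free
    entry.\<close>
  have "bij_betw (\<lambda>(b, k). (b(l := k), b l)) (SIGMA b:P. {k\<in>S l. b(l := k) \<in> X}) ((X \<inter> P) \<times> S l)"
    by (rule bij_betw_byWitness[where f' = "\<lambda>(b, k). (b(l := k), b l)"])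
       (use mem mem_l in \<open>auto simp: image_iff\<close>)
  then have "card (SIGMA b:P. {k\<in>S l. b(l := k) \<in> X}) = card ((X \<inter> P) \<times> S l)"
    by (rule bij_betw_same_card)
  then have "(\<Sum>b\<in>P. card {k\<in>S l. b(l := k) \<in> X}) = card (X \<inter> P) * card (S l)"
    using finP fin by (simp add: card_cartesian_product)
  then have "real (card (X \<inter> P)) * real (card (S l)) = (\<Sum>b\<in>P. real (card {k\<in>S l. b(l := k) \<in> X}))"
    by (simp only: of_nat_mult[symmetric] of_nat_sum[symmetric])
  also have "\<dots> \<le> (\<Sum>b\<in>P. \<kappa> * real (card (S l)))" by (intro sum_mono fibre) (simp add: P_def)
  also have "\<dots> = \<kappa> * real (card P) * real (card (S l))" by simp
  finally show ?thesis
    using ne fin[of l] by (simp add: card_gt_0_iff P_def)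
qed

section \<open>Nested grids of anisotropic cells\<close>

text \<open>\<open>E m i\<close> is the number of level-\<open>m\<close> cells per unit length in direction \<open>i\<close>.\<close>

locale box_grid =
  fixes E D :: "nat \<Rightarrow> 'n::finite \<Rightarrow> nat"
  assumes E_0: "E 0 i = 1"
    and E_Suc: "E (Suc m) i = E m i * D m i"
    and D_pos: "0 < D m i"
begin

text \<open>Closed, so that nested cells share a point by compactness. Neighbouring cells overlap in
  faces, which is why ancestry is expressed through indices instead.\<close>

definition cell :: "nat \<Rightarrow> ('n \<Rightarrow> int) \<Rightarrow> (real ^ 'n) set" where
  "cell m a = {x. \<forall>i. of_int (a i) \<le> x $ i * real (E m i) \<and> x $ i * real (E m i) \<le> of_int (a i) + 1}"

text \<open>The lower corner of the level-\<open>M\<close> cell \<open>b\<close> lies in the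
  half-open level-\<open>m\<close> cell \<open>a\<close>, with denominators cleared. Half-openness
  makes ancestors unique, so no obstacle is counted under two children.\<close>

definition below :: "nat \<Rightarrow> ('n \<Rightarrow> int) \<Rightarrow> nat \<Rightarrow> ('n \<Rightarrow> int) \<Rightarrow> bool" where
  "below M b m a \<longleftrightarrow> (\<forall>i. a i * int (E M i) \<le> b i * int (E m i) \<and> b i * int (E m i) < (a i + 1) * int (E M i))"

definition children :: "nat \<Rightarrow> ('n \<Rightarrow> int) \<Rightarrow> ('n \<Rightarrow> int) set" where
  "children m a = Pi UNIV (\<lambda>i. {a i * int (D m i)..<a i * int (D m i) + int (D m i)})"

text \<open>The number of level-\<open>m\<close> cells in the unit cube, hence the reciprocal of the
  volume of one cell.\<close>

definition ncells :: "nat \<Rightarrow> real" where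
  "ncells m = (\<Prod>i\<in>UNIV. real (E m i))"

lemma E_pos: "0 < E m i"
  by (induction m) (simp_all add: E_0 E_Suc D_pos)

lemma E_ge_power:
  assumes "\<And>m. 2 \<le> D m i"
  shows "2 ^ m \<le> E m i"
proof (induction m)
  case (Suc m)
  then show ?case using mult_le_mono[OF Suc assms[of m]] by (simp add: E_Suc mult.commute)
qed (simp add: E_0)

lemma ncells_pos: "0 < ncells m"
  unfolding ncells_def using E_pos by (intro prod_pos) simp

lemma finite_children: "finite (children m a)"
  using finite_PiE[of UNIV "\<lambda>i. {a i * int (D m i)..<a i * int (D m i) + int (D m i)}"]
  by (simp add: children_def PiE_def)

lemma card_children: "real (card (children m a)) = ncells (Suc m) / ncells m"
proof -
  have "card (children m a) = (\<Prod>i\<in>UNIV. D m i)"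
    using card_PiE[of UNIV "\<lambda>i. {a i * int (D m i)..<a i * int (D m i) + int (D m i)}"]
    by (simp add: children_def PiE_def)
  moreover have "ncells (Suc m) = ncells m * (\<Prod>i\<in>UNIV. real (D m i))"
    by (simp add: ncells_def E_Suc prod.distrib)
  ultimately show ?thesis using ncells_pos[of m] by simp
qed

lemma children_bounds:
  assumes "c \<in> children m a"
  shows "a i * int (D m i) \<le> c i" "c i + 1 \<le> (a i + 1) * int (D m i)"
proof -
  have "c i \<in> {a i * int (D m i)..<a i * int (D m i) + int (D m i)}"
    using assms by (auto simp: children_def)
  then show "a i * int (D m i) \<le> c i" "c i + 1 \<le> (a i + 1) * int (D m i)"
    by (simp_all add: distrib_right)
qed

lemma below_self_iff: "below m b m a \<longleftrightarrow> b = a"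
proof -
  have "a i * int (E m i) \<le> b i * int (E m i) \<and> b i * int (E m i) < (a i + 1) * int (E m i)
      \<longleftrightarrow> b i = a i" for i
    using E_pos[of m i] by auto
  then show ?thesis by (auto simp: below_def fun_eq_iff)
qed

lemma below_child:
  assumes "c \<in> children m a" "below M b (Suc m) c"
  shows "below M b m a"
  unfolding below_def
proof
  fix i
  have c: "a i * int (D m i) \<le> c i" "c i + 1 \<le> (a i + 1) * int (D m i)"
    using children_bounds[OF assms(1)] by auto
  have b: "c i * int (E M i) \<le> b i * (int (E m i) * int (D m i))"
    "b i * (int (E m i) * int (D m i)) < (c i + 1) * int (E M i)"
    using assms(2) by (simp_all add: below_def E_Suc)
  have D: "0 < int (D m i)" using D_pos[of m i] by simp
  have "(a i * int (E M i)) * int (D m i) \<le> c i * int (E M i)"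
    using mult_right_mono[OF c(1), of "int (E M i)"] by (simp add: algebra_simps)
  also have "\<dots> \<le> (b i * int (E m i)) * int (D m i)" using b(1) by (simp add: algebra_simps)
  finally have 1: "a i * int (E M i) \<le> b i * int (E m i)" using D by simp
  have "(b i * int (E m i)) * int (D m i) < (c i + 1) * int (E M i)"
    using b(2) by (simp add: algebra_simps)
  also have "\<dots> \<le> ((a i + 1) * int (E M i)) * int (D m i)"
    using mult_right_mono[OF c(2), of "int (E M i)"] by (simp add: algebra_simps)
  finally have 2: "b i * int (E m i) < (a i + 1) * int (E M i)" using D by simp
  show "a i * int (E M i) \<le> b i * int (E m i) \<and> b i * int (E m i) < (a i + 1) * int (E M i)"
    using 1 2 by simp
qed

lemma below_unique:
  assumes "below M b m a" "below M b m a'"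
  shows "a = a'"
proof
  fix i
  have e: "0 < int (E M i)" using E_pos by simp
  have "a i * int (E M i) < (a' i + 1) * int (E M i)" "a' i * int (E M i) < (a i + 1) * int (E M i)"
    using assms by (force simp: below_def intro: le_less_trans)+
  then show "a i = a' i" using e by (simp add: mult_less_cancel_right)
qed

lemma cell_child_subset:
  assumes "c \<in> children m a"
  shows "cell (Suc m) c \<subseteq> cell m a"
proof
  fix x assume x: "x \<in> cell (Suc m) c"
  show "x \<in> cell m a"
    unfolding cell_def
  proof (safe)
    fix i
    have c: "a i * int (D m i) \<le> c i" "c i + 1 \<le> (a i + 1) * int (D m i)"
      using children_bounds[OF assms(1)] by auto
    have c': "of_int (a i) * real (D m i) \<le> of_int (c i)" "of_int (c i) + 1 \<le> (of_int (a i) + 1) * real (D m i)"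
      using c[THEN of_int_le_iff[where 'a = real, THEN iffD2]] by simp_all
    have b: "of_int (c i) \<le> x $ i * (real (E m i) * real (D m i))"
      "x $ i * (real (E m i) * real (D m i)) \<le> of_int (c i) + 1"
      using x by (simp_all add: cell_def E_Suc)
    have D: "0 < real (D m i)" using D_pos[of m i] by simp
    have "of_int (a i) * real (D m i) \<le> (x $ i * real (E m i)) * real (D m i)"
      using c'(1) b(1) by (simp add: algebra_simps)
    then show "of_int (a i) \<le> x $ i * real (E m i)" using D by simp
    have "(x $ i * real (E m i)) * real (D m i) \<le> (of_int (a i) + 1) * real (D m i)"
      using c'(2) b(2) by (simp add: algebra_simps)
    then show "x $ i * real (E m i) \<le> of_int (a i) + 1" using D by simp
  qed
qed

lemma cell_eq_cbox:
  "cell m a = cbox (\<chi> i. of_int (a i) / real (E m i)) (\<chi> i. (of_int (a i) + 1) / real (E m i))"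
  using E_pos by (auto simp: cell_def mem_box_cart field_simps)

lemma cell_nonempty: "cell m a \<noteq> {}"
proof -
  have "(\<chi> i. of_int (a i) / real (E m i)) \<in> cell m a"
    using E_pos by (auto simp: cell_def less_imp_neq)
  then show ?thesis by auto
qed

lemma nested_cells_point:
  assumes "\<And>m. a (Suc m) \<in> children m (a m)"
  obtains x where "\<And>m. x \<in> cell m (a m)"
proof -
  have "(\<Inter>m. cell m (a m)) \<noteq> {}"
  proof (rule compact_nest)
    show "compact (cell m (a m))" for m by (simp add: cell_eq_cbox)
    show "cell m (a m) \<noteq> {}" for m by (rule cell_nonempty)
    show "cell n (a n) \<subseteq> cell m (a m)" if "m \<le> n" for m n
      using that cell_child_subset[OF assms] by (rule lift_Suc_antimono_le[rotated])
  qed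
  then show ?thesis using that by auto
qed

text \<open>The invariant kept along the branch is that the obstacles of level at least \<open>m\<close> below the
  current cell have total weight less than \<open>2 ^ m / ncells m\<close>: averaging over the good children,
  which are at least half of all children, shows that it can be passed on, and at level \<open>lev k\<close>
  it forbids every cell of \<open>hit k\<close>, whose weight alone is \<open>2 ^ lev k / ncells (lev k)\<close>.\<close>

lemma branch_avoiding_obstacles:
  fixes G :: "nat \<Rightarrow> ('n \<Rightarrow> int) \<Rightarrow> ('n \<Rightarrow> int) \<Rightarrow> bool"
    and hit :: "nat \<Rightarrow> ('n \<Rightarrow> int) set" and lev :: "nat \<Rightarrow> nat"
  assumes good: "\<And>m a. real (card (children m a)) \<le> 2 * real (card {b\<in>children m a. G m a b})"
    and fin: "\<And>k. finite (hit k)"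
    and weight: "(\<Sum>k. ennreal (2 ^ lev k / ncells (lev k) * real (card (hit k)))) < 1"
  obtains a where "\<And>m. a (Suc m) \<in> children m (a m)" "\<And>m. G m (a m) (a (Suc m))"
    "\<And>k. a (lev k) \<notin> hit k"
proof -
  define h where "h k m a = (if m \<le> lev k then
      ennreal (2 ^ lev k / ncells (lev k) * real (card {b\<in>hit k. below (lev k) b m a})) else 0)"
    for k m a
  define Q where "Q m a = (\<Sum>k. h k m a)" for m a
  define P where "P m a \<longleftrightarrow> Q m a < ennreal (2 ^ m / ncells m)" for m and a :: "'n \<Rightarrow> int"
  have coeff: "0 \<le> 2 ^ m / ncells m" for m using ncells_pos[of m] by simp
  have start: "P 0 (\<lambda>_. 0)"
  proof -
    have "Q 0 (\<lambda>_. 0) \<le> (\<Sum>k. ennreal (2 ^ lev k / ncells (lev k) * real (card (hit k))))"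
      unfolding Q_def h_def using coeff fin
      by (intro suminf_le) (auto simp del: times_divide_eq_left intro!: ennreal_leI mult_left_mono card_mono)
    also have "\<dots> < 1" by (rule weight)
    finally show ?thesis by (simp add: P_def ncells_def E_0)
  qed
  have step: "\<exists>b. P (Suc m) b \<and> b \<in> children m a \<and> G m a b" if "P m a" for m a
  proof (rule ccontr)
    assume no: "\<not> ?thesis"
    let ?S = "{b\<in>children m a. G m a b}"
    have finS: "finite ?S" using finite_children by simp
    have large: "ennreal (2 ^ Suc m / ncells (Suc m)) \<le> Q (Suc m) b" if "b \<in> ?S" for b
      using no that by (auto simp: P_def not_less)
    have split: "(\<Sum>b\<in>?S. h k (Suc m) b) \<le> h k m a" for k
    proof (cases "Suc m \<le> lev k")
      case True
      let ?B = "\<lambda>b. {x\<in>hit k. below (lev k) x (Suc m) b}"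
      \<comment> \<open>Distinct children have disjoint sets of descendants, so the obstacle weights
        below the good children sum to at most the weight below \<open>a\<close>.\<close>
      have "(\<Sum>b\<in>?S. card (?B b)) = card (\<Union>b\<in>?S. ?B b)"
        using fin finS by (intro card_UN_disjoint[symmetric]) (auto dest: below_unique)
      also have "\<dots> \<le> card {x\<in>hit k. below (lev k) x m a}"
        using fin by (intro card_mono) (auto intro: below_child)
      finally have "(\<Sum>b\<in>?S. real (card (?B b))) \<le> real (card {x\<in>hit k. below (lev k) x m a})"
        by (simp only: of_nat_sum[symmetric] of_nat_le_iff)
      then have "2 ^ lev k / ncells (lev k) * (\<Sum>b\<in>?S. real (card (?B b)))
          \<le> 2 ^ lev k / ncells (lev k) * real (card {x\<in>hit k. below (lev k) x m a})"
        using coeff by (intro mult_left_mono)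
      then have "ennreal (\<Sum>b\<in>?S. 2 ^ lev k / ncells (lev k) * real (card (?B b)))
          \<le> ennreal (2 ^ lev k / ncells (lev k) * real (card {x\<in>hit k. below (lev k) x m a}))"
        unfolding sum_distrib_left by (rule ennreal_leI)
      then have "(\<Sum>b\<in>?S. ennreal (2 ^ lev k / ncells (lev k) * real (card (?B b))))
          \<le> ennreal (2 ^ lev k / ncells (lev k) * real (card {x\<in>hit k. below (lev k) x m a}))"
        using coeff by (subst sum_ennreal) (auto simp del: times_divide_eq_left intro!: mult_nonneg_nonneg)
      then show ?thesis using True by (simp add: h_def)
    qed (simp add: h_def)
    \<comment> \<open>At least half of the \<open>ncells (Suc m) / ncells m\<close> children are
      good. The extra factor 2 in the threshold of level \<open>Suc m\<close> compensates exactly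
      for the lost half.\<close>
    have "2 ^ m / ncells m \<le> real (card ?S) * (2 ^ Suc m / ncells (Suc m))"
    proof -
      have "2 ^ m / ncells m = (ncells (Suc m) / ncells m) * (2 ^ m / ncells (Suc m))"
        using ncells_pos[of "Suc m"] by simp
      also have "\<dots> \<le> (2 * real (card ?S)) * (2 ^ m / ncells (Suc m))"
        using good[of m a] coeff[of m] ncells_pos[of "Suc m"]
        by (intro mult_right_mono) (auto simp: card_children)
      finally show ?thesis by (simp add: algebra_simps)
    qed
    then have "ennreal (2 ^ m / ncells m) \<le> ennreal (real (card ?S) * (2 ^ Suc m / ncells (Suc m)))"
      by (rule ennreal_leI)
    also have "\<dots> = (\<Sum>b\<in>?S. ennreal (2 ^ Suc m / ncells (Suc m)))"
      using coeff[of "Suc m"]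
      by (simp only: sum_constant ennreal_of_nat_eq_real_of_nat ennreal_mult of_nat_0_le_iff)
    also have "\<dots> \<le> (\<Sum>b\<in>?S. Q (Suc m) b)" by (intro sum_mono large)
    also have "\<dots> = (\<Sum>k. \<Sum>b\<in>?S. h k (Suc m) b)"
      unfolding Q_def by (rule suminf_sum[symmetric]) auto
    also have "\<dots> \<le> (\<Sum>k. h k m a)" by (intro suminf_le split) auto
    also have "\<dots> < ennreal (2 ^ m / ncells m)" using that by (simp add: P_def Q_def)
    finally show False by simp
  qed
  obtain a where a: "\<And>m. P m (a m)" "\<And>m. a (Suc m) \<in> children m (a m) \<and> G m (a m) (a (Suc m))"
    using dependent_nat_choice[of P "\<lambda>m a b. b \<in> children m a \<and> G m a b"] start step by blast
  have "a (lev k) \<notin> hit k" for k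
  proof
    assume hit: "a (lev k) \<in> hit k"
    have "{b\<in>hit k. below (lev k) b (lev k) (a (lev k))} = {a (lev k)}"
      using hit by (auto simp: below_self_iff)
    then have "h k (lev k) (a (lev k)) = ennreal (2 ^ lev k / ncells (lev k))"
      by (simp add: h_def)
    moreover have "h k (lev k) (a (lev k)) \<le> Q (lev k) (a (lev k))"
      unfolding Q_def using sum_le_suminf[of "\<lambda>k'. h k' (lev k) (a (lev k))" "{k}"] by simp
    moreover have "Q (lev k) (a (lev k)) < ennreal (2 ^ lev k / ncells (lev k))"
      using a(1) by (simp add: P_def)
    ultimately show False by simp
  qed
  then show ?thesis using that a(2) by blast
qed

end

section \<open>Excluding slabs and rationals\<close>

definition ldot :: "('n::finite \<Rightarrow> int) \<Rightarrow> real ^ 'n \<Rightarrow> real" where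
  "ldot v x = (\<Sum>i\<in>UNIV. of_int (v i) * x $ i)"

text \<open>Distinct fractions differ by at least \<open>1 / (q * q')\<close>. The closeness
  assumptions put them within \<open>2 / e\<close>, so
  \<open>e \<le> 2 * q * q' \<le> q\<^sup>2 + q'\<^sup>2\<close>, while the size assumptions make
  the last sum less than \<open>e / 2\<close>.\<close>

lemma rationals_close_imp_equal:
  fixes e x x' :: real and p p' q q' :: int
  assumes "0 < e" "0 < q" "0 < q'" "4 * of_int q ^ 2 < e" "4 * of_int q' ^ 2 < e"
    and "\<bar>x - of_int p / of_int q\<bar> \<le> 1 / (4 * e)" "\<bar>x' - of_int p' / of_int q'\<bar> \<le> 1 / (4 * e)"
    and "\<bar>x - x'\<bar> \<le> 1 / e"
  shows "of_int p / of_int q = (of_int p' / of_int q' :: real)"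
proof (rule ccontr)
  assume ne: "\<not> ?thesis"
  have q: "0 < real_of_int q" "0 < real_of_int q'" using assms by auto
  have "p * q' - p' * q \<noteq> 0"
  proof
    assume "p * q' - p' * q = 0"
    then have "real_of_int p * of_int q' = of_int p' * of_int q"
      by (metis eq_iff_diff_eq_0 of_int_mult)
    then show False using ne q by (simp add: field_simps)
  qed
  then have "1 \<le> \<bar>real_of_int (p * q' - p' * q)\<bar>" by linarith
  then have "1 / (real_of_int q * of_int q') \<le> \<bar>real_of_int (p * q' - p' * q)\<bar> / (real_of_int q * of_int q')"
    using q by (intro divide_right_mono) auto
  also have "\<dots> = \<bar>(of_int p * of_int q' - of_int p' * of_int q) / (real_of_int q * of_int q')\<bar>"
    using q by (simp add: abs_mult)
  also have "(of_int p * of_int q' - of_int p' * of_int q) / (real_of_int q * of_int q')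
      = of_int p / of_int q - of_int p' / of_int q'"
    using q by (simp add: field_simps)
  also have "\<bar>of_int p / of_int q - real_of_int p' / of_int q'\<bar> \<le> 2 / e"
    using assms(6-8) by (simp add: field_simps)
  finally have "e \<le> 2 * (real_of_int q * of_int q')" using q assms(1) by (simp add: field_simps)
  moreover have "2 * (real_of_int q * of_int q') \<le> of_int q ^ 2 + of_int q' ^ 2"
    using zero_le_power2[of "real_of_int q - of_int q'"] by (simp add: power2_diff)
  ultimately show False using assms(1,4,5) by linarith
qed

section \<open>Proportion of children lost to the slabs of one form or to rationals\<close>

context box_grid
begin

lemma card_children_line:
  fixes X :: "('n \<Rightarrow> int) set"
  assumes "\<And>b. b \<in> children m a \<Longrightarrow>
    real (card {k\<in>{a l * int (D m l)..<a l * int (D m l) + int (D m l)}. b(l := k) \<in> X}) \<le> \<kappa> * real (D m l)"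
  shows "real (card (X \<inter> children m a)) \<le> \<kappa> * real (card (children m a))"
  unfolding children_def
  by (rule card_Pi_fibre_bound[where l = l]) (use assms D_pos[of m l] in \<open>auto simp: children_def\<close>)

text \<open>A form that enters the box only at level \<open>Suc m\<close> has a coefficient large
  enough to move noticeably across a level-\<open>m\<close> cell, yet all its coefficients are small
  relative to level \<open>Suc m\<close>, so it is nearly constant on each child. Along the dominant
  direction its values at the corners form a progression, of which few terms are near
  integers.\<close>

lemma card_strip_children:
  fixes v :: "'n \<Rightarrow> int" and c :: real
  assumes c: "0 < c" "c \<le> 1 / (8 * (2 * real CARD('n) + 7))"
    and D_ge: "\<And>i. 8 * (4 * real CARD('n) + 2) \<le> real (D m i)"
    and v_le: "\<And>i. \<bar>of_int (v i)\<bar> \<le> c * real (E (Suc m) i)"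
    and v_gt: "\<not> (\<forall>i. \<bar>of_int (v i)\<bar> \<le> c * real (E m i))"
  shows "real (card ({b. \<exists>x\<in>cell (Suc m) b. \<exists>p::int. \<bar>ldot v x - of_int p\<bar> < c\<^sup>2} \<inter> children m a))
           \<le> 1 / 4 * real (card (children m a))"
proof -
  define n where "n = real CARD('n)"
  have n: "1 \<le> n" by (simp add: n_def Suc_le_eq)
  define r where "r i = \<bar>real_of_int (v i)\<bar> / real (E m i)" for i
  \<comment> \<open>Direction in which the form varies most over a level-\<open>m\<close> cell. As
    \<open>v\<close> is outside the smaller box, this variation \<open>r l\<close> exceeds
    \<open>c\<close>.\<close>
  obtain l where l: "\<And>i. r i \<le> r l"
  proof -
    have "Max (range r) \<in> range r" by (intro Max_in) auto
    then obtain l where "Max (range r) = r l" by (rule rangeE)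
    then show ?thesis using that[of l] by (metis Max_ge finite finite_imageI rangeI)
  qed
  have Em: "0 < real (E m i)" for i using E_pos by simp
  have Dm: "0 < real (D m i)" for i using D_pos by simp
  have rl: "c < r l"
  proof -
    obtain i where "c * real (E m i) < \<bar>real_of_int (v i)\<bar>" using v_gt by (auto simp: not_le)
    then have "c < r i" using Em[of i] by (simp add: r_def field_simps)
    then show ?thesis using l[of i] by simp
  qed
  \<comment> \<open>Width of the slab plus the oscillation of the form over a child: a child meeting
    the slab has its corner value within \<open>\<rho>\<close> of an integer.\<close>
  define \<rho> where "\<rho> = c\<^sup>2 + (\<Sum>i\<in>UNIV. \<bar>real_of_int (v i)\<bar> / real (E (Suc m) i))"
  define \<sigma> where "\<sigma> = real_of_int (v l) / real (E (Suc m) l)"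
  define B where "B = 8 * (4 * n + 2)"
  have B: "0 < B" using n by (simp add: B_def)
  have quot: "\<bar>real_of_int (v i)\<bar> / real (E (Suc m) i) \<le> r l / B" for i
  proof -
    have "\<bar>real_of_int (v i)\<bar> / real (E (Suc m) i) = r i / real (D m i)"
      by (simp add: r_def E_Suc)
    also have "\<dots> \<le> r l / B"
      using l[of i] D_ge[of i] B rl c by (intro frac_le) (auto simp: B_def n_def)
    finally show ?thesis .
  qed
  have quot': "\<bar>real_of_int (v i)\<bar> / real (E (Suc m) i) \<le> c" for i
    using v_le[of i] E_pos[of "Suc m" i] by (simp add: field_simps)
  have \<sigma>_abs: "\<bar>\<sigma>\<bar> = r l / real (D m l)" by (simp add: \<sigma>_def r_def E_Suc)
  have \<sigma>_nz: "\<sigma> \<noteq> 0" using \<sigma>_abs rl c Dm[of l] by auto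
  have \<sigma>1: "\<bar>\<sigma>\<bar> \<le> c" using quot'[of l] by (simp add: \<sigma>_def)
  have \<sigma>2: "\<bar>\<sigma>\<bar> \<le> r l / B" using quot[of l] by (simp add: \<sigma>_def)
  have \<rho>1: "\<rho> \<le> c\<^sup>2 + n * c"
    using sum_bounded_above[of UNIV "\<lambda>i. \<bar>real_of_int (v i)\<bar> / real (E (Suc m) i)" c] quot'
    by (simp add: \<rho>_def n_def)
  have \<rho>2: "\<rho> \<le> c\<^sup>2 + n * (r l / B)"
    using sum_bounded_above[of UNIV "\<lambda>i. \<bar>real_of_int (v i)\<bar> / real (E (Suc m) i)" "r l / B"] quot
    by (simp add: \<rho>_def n_def)
  have \<rho>0: "0 \<le> \<rho>" by (auto simp: \<rho>_def intro!: add_nonneg_nonneg sum_nonneg)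
  have c8: "(2 * n + 7) * c \<le> 1 / 8"
    using c(2) n by (simp add: n_def field_simps)
  have nc: "0 \<le> n * c" using c n by simp
  have c1: "c \<le> 1 / 56" using c8 nc by (simp add: algebra_simps)
  have c2: "c\<^sup>2 \<le> c" using c c1 by (simp add: power2_eq_square mult_left_le)
  have \<rho>_half: "\<rho> \<le> 1 / 2" using \<rho>1 c2 c8 nc c(1) by (simp add: algebra_simps)
  have near: "\<exists>p::int. \<bar>ldot v (\<chi> i. of_int (b i) / real (E (Suc m) i)) - of_int p\<bar> \<le> \<rho>"
    if x: "x \<in> cell (Suc m) b" and p: "\<bar>ldot v x - of_int p\<bar> < c\<^sup>2" for x b and p :: int
  proof -
    define y where "y = (\<chi> i. of_int (b i) / real (E (Suc m) i))"
    have "\<bar>x $ i - y $ i\<bar> \<le> 1 / real (E (Suc m) i)" for i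
    proof -
      have "of_int (b i) \<le> x $ i * real (E (Suc m) i)" "x $ i * real (E (Suc m) i) \<le> of_int (b i) + 1"
        using x by (simp_all add: cell_def)
      then have "of_int (b i) / real (E (Suc m) i) \<le> x $ i" "x $ i \<le> (of_int (b i) + 1) / real (E (Suc m) i)"
        using E_pos[of "Suc m" i] by (simp_all add: pos_divide_le_eq pos_le_divide_eq)
      then show ?thesis by (simp add: y_def abs_le_iff add_divide_distrib)
    qed
    then have "\<bar>of_int (v i) * x $ i - of_int (v i) * y $ i\<bar> \<le> \<bar>of_int (v i)\<bar> / real (E (Suc m) i)" for i
      using mult_left_mono[of "\<bar>x $ i - y $ i\<bar>" "1 / real (E (Suc m) i)" "\<bar>real_of_int (v i)\<bar>"]
      by (simp add: abs_mult[symmetric] right_diff_distrib)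
    then have "\<bar>ldot v x - ldot v y\<bar> \<le> (\<Sum>i\<in>UNIV. \<bar>real_of_int (v i)\<bar> / real (E (Suc m) i))"
      unfolding ldot_def sum_subtractf[symmetric] by (intro order_trans[OF sum_abs] sum_mono)
    then have "\<bar>ldot v y - of_int p\<bar> \<le> \<rho>" using p unfolding \<rho>_def by linarith
    then show ?thesis by (auto simp: y_def)
  qed
  show ?thesis
  proof (rule card_children_line[where l = l])
    fix b assume "b \<in> children m a"
    define \<beta> where "\<beta> = (\<Sum>i\<in>UNIV - {l}. of_int (v i) * (of_int (b i) / real (E (Suc m) i)))"
    let ?I = "{a l * int (D m l)..<a l * int (D m l) + int (D m l)}"
    have line: "ldot v (\<chi> i. of_int ((b(l := k)) i) / real (E (Suc m) i)) = \<beta> + of_int k * \<sigma>" for k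
      by (simp add: ldot_def sum.remove[of UNIV l] \<beta>_def \<sigma>_def)
    have "{k\<in>?I. b(l := k) \<in> {b. \<exists>x\<in>cell (Suc m) b. \<exists>p::int. \<bar>ldot v x - of_int p\<bar> < c\<^sup>2}}
        \<subseteq> {k\<in>?I. \<exists>p::int. \<bar>\<beta> + of_int k * \<sigma> - of_int p\<bar> \<le> \<rho>}"
      using near[where b = "b(l := _)", unfolded line] by blast
    then have "card {k\<in>?I. b(l := k) \<in> {b. \<exists>x\<in>cell (Suc m) b. \<exists>p::int. \<bar>ldot v x - of_int p\<bar> < c\<^sup>2}}
        \<le> card {k\<in>?I. \<exists>p::int. \<bar>\<beta> + of_int k * \<sigma> - of_int p\<bar> \<le> \<rho>}"
      by (rule card_mono[rotated]) (rule finite_subset[of _ ?I], auto)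
    then have "real (card {k\<in>?I. b(l := k) \<in> {b. \<exists>x\<in>cell (Suc m) b. \<exists>p::int. \<bar>ldot v x - of_int p\<bar> < c\<^sup>2}})
        \<le> (real (D m l) * \<bar>\<sigma>\<bar> + 2) * (2 * \<rho> / \<bar>\<sigma>\<bar> + 1)"
      using card_progression_near_integers[OF \<sigma>_nz \<rho>0 \<rho>_half, of "a l * int (D m l)" "D m l" \<beta>] by linarith
    also have "\<dots> = (2 * \<rho> + \<bar>\<sigma>\<bar> + (4 * \<rho> + 2 * \<bar>\<sigma>\<bar>) / r l) * real (D m l)"
      using \<sigma>_nz Dm[of l] rl c unfolding \<sigma>_abs by (simp add: field_simps)
    also have "\<dots> \<le> 1 / 4 * real (D m l)"
    proof (rule mult_right_mono)
      \<comment> \<open>The terms divided by \<open>r l\<close> need the bounds proportional to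
        \<open>r l\<close> (\<open>\<rho>2\<close>, \<open>\<sigma>2\<close>), and the choice of
        \<open>B\<close> makes their main part \<open>1 / 8\<close>. The other terms use the
        absolute bounds \<open>\<rho>1\<close> and \<open>\<sigma>1\<close>. Everything multiplying
        \<open>c\<close> adds up to \<open>2 * n + 7\<close>, and the assumption on \<open>c\<close>
        makes that part at most \<open>1 / 8\<close> too.\<close>
      have "(4 * \<rho> + 2 * \<bar>\<sigma>\<bar>) / r l \<le> (4 * c\<^sup>2 + (4 * n + 2) * (r l / B)) / r l"
      proof (rule divide_right_mono)
        have "(4 * n + 2) * (r l / B) = 4 * (n * (r l / B)) + 2 * (r l / B)" by (rule distrib_right[of "4 * n" 2, unfolded mult.assoc])
        then show "4 * \<rho> + 2 * \<bar>\<sigma>\<bar> \<le> 4 * c\<^sup>2 + (4 * n + 2) * (r l / B)"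
          using \<rho>2 \<sigma>2 by linarith
      qed (use rl c in simp)
      also have "\<dots> = 4 * c\<^sup>2 / r l + (4 * n + 2) / B"
        using rl c by (simp add: add_divide_distrib)
      also have "(4 * n + 2) / B = 1 / 8" using n by (simp add: B_def)
      also have "4 * c\<^sup>2 / r l \<le> 4 * c"
        using rl c by (simp add: power2_eq_square divide_le_eq)
      finally have 1: "(4 * \<rho> + 2 * \<bar>\<sigma>\<bar>) / r l \<le> 4 * c + 1 / 8" by simp
      have "2 * \<rho> + \<bar>\<sigma>\<bar> \<le> 2 * c + 2 * (n * c) + c" using \<rho>1 c2 \<sigma>1 by linarith
      moreover have "(2 * n + 7) * c = 2 * (n * c) + 7 * c" by (simp add: algebra_simps)
      ultimately show "2 * \<rho> + \<bar>\<sigma>\<bar> + (4 * \<rho> + 2 * \<bar>\<sigma>\<bar>) / r l \<le> 1 / 4"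
        using 1 c8 by linarith
    qed simp
    finally show "real (card {k\<in>?I. b(l := k) \<in> {b. \<exists>x\<in>cell (Suc m) b. \<exists>p::int. \<bar>ldot v x - of_int p\<bar> < c\<^sup>2}})
        \<le> 1 / 4 * real (D m l)" .
  qed
qed

text \<open>For denominators with \<open>q\<^sup>2\<close> comparable to \<open>E m i\<close>, at
  most one rational can be dangerous for points of the parent cell. Its neighbourhood is a
  \<open>1 / (8 * n)\<close> fraction of the side of the parent, and the two children at its ends
  cost at most as much again because \<open>D m i\<close> is large.\<close>

lemma card_rational_children:
  fixes \<epsilon> d :: real
  assumes D_ge: "8 * (4 * real CARD('n) + 2) \<le> real (D m i)"
    and \<epsilon>: "0 < \<epsilon>" "4 * d * \<epsilon> \<le> 1 / (16 * real CARD('n))" and d: "0 < d"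
  shows "real (card ({b. \<exists>x\<in>cell (Suc m) b. \<exists>q p::int. 0 < q \<and> 4 * of_int q ^ 2 < real (E m i) \<and>
      real (E m i) \<le> 4 * d * of_int q ^ 2 \<and> \<bar>x $ i - of_int p / of_int q\<bar> < \<epsilon> / of_int q ^ 2} \<inter> children m a))
       \<le> 1 / (4 * real CARD('n)) * real (card (children m a))"
proof -
  define n where "n = real CARD('n)"
  have n: "1 \<le> n" by (simp add: n_def Suc_le_eq)
  define e where "e = real (E m i)"
  have e: "0 < e" using E_pos by (simp add: e_def)
  \<comment> \<open>Uniform bound for all radii \<open>\<epsilon> / q\<^sup>2\<close> that occur,
    from \<open>e \<le> 4 * d * q\<^sup>2\<close> and the assumption on
    \<open>4 * d * \<epsilon>\<close>.\<close>
  define \<rho> where "\<rho> = 1 / (16 * n * e)"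
  define bad where "bad x r \<longleftrightarrow> (\<exists>q p::int. 0 < q \<and> 4 * of_int q ^ 2 < e \<and>
      e \<le> 4 * d * of_int q ^ 2 \<and> \<bar>x $ i - of_int p / of_int q\<bar> < \<epsilon> / of_int q ^ 2 \<and> r = of_int p / of_int q)"
    for x :: "real ^ 'n" and r :: real
  have bad_close: "\<bar>x $ i - r\<bar> < \<rho>" if bad: "bad x r" for x r
  proof -
    obtain q p :: int where q: "0 < q" "e \<le> 4 * d * of_int q ^ 2" "r = of_int p / of_int q"
      and lt: "\<bar>x $ i - r\<bar> < \<epsilon> / of_int q ^ 2"
      using bad unfolding bad_def by blast
    have "\<epsilon> / of_int q ^ 2 = (4 * d * \<epsilon>) / (4 * d * of_int q ^ 2)" using d by simp
    also have "\<dots> \<le> (1 / (16 * n)) / e"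
      using q \<epsilon> e d by (intro frac_le) (auto simp: n_def)
    finally show ?thesis using lt by (simp add: \<rho>_def)
  qed
  have \<rho>4: "\<rho> \<le> 1 / (4 * e)" unfolding \<rho>_def using n e by (intro divide_left_mono) auto
  have unique: "r = r'" if bad: "bad x r" "bad x' r'" "\<bar>x $ i - x' $ i\<bar> \<le> 1 / e" for x x' r r'
  proof -
    obtain q p :: int where q: "0 < q" "4 * of_int q ^ 2 < e" "r = of_int p / of_int q"
      using bad(1) unfolding bad_def by blast
    obtain q' p' :: int where q': "0 < q'" "4 * of_int q' ^ 2 < e" "r' = of_int p' / of_int q'"
      using bad(2) unfolding bad_def by blast
    show ?thesis unfolding q(3) q'(3)
      by (rule rationals_close_imp_equal[OF e q(1) q'(1) q(2) q'(2) _ _ bad(3)])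
         (use bad_close[OF bad(1)] bad_close[OF bad(2)] q q' \<rho>4 in auto)
  qed
  have cell_diff: "\<bar>x $ i - x' $ i\<bar> \<le> 1 / e" if "x \<in> cell m a" "x' \<in> cell m a" for x x'
  proof -
    have "of_int (a i) \<le> x $ i * e" "x $ i * e \<le> of_int (a i) + 1"
      "of_int (a i) \<le> x' $ i * e" "x' $ i * e \<le> of_int (a i) + 1"
      using that by (auto simp: cell_def e_def)
    then have "\<bar>x $ i * e - x' $ i * e\<bar> \<le> 1" by linarith
    then have "\<bar>x $ i - x' $ i\<bar> * e \<le> 1" using e by (simp add: abs_mult left_diff_distrib[symmetric])
    then show ?thesis using e by (simp add: field_simps)
  qed
  obtain r where r: "\<And>x r'. x \<in> cell m a \<Longrightarrow> bad x r' \<Longrightarrow> r' = r"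
    using unique cell_diff by metis
  let ?e = "real (E (Suc m) i)"
  have e': "?e = e * real (D m i)" by (simp add: e_def E_Suc)
  have e'0: "0 < ?e" using E_pos by simp
  define X where "X = {b. \<exists>x\<in>cell (Suc m) b. \<exists>r. bad x r}"
  \<comment> \<open>The doubled intersection records on each line that \<open>b(i := k)\<close> is a
    child, so that its cell lies in \<open>cell m a\<close> and the rational found there must be
    \<open>r\<close>.\<close>
  have "real (card (X \<inter> children m a)) = real (card ((X \<inter> children m a) \<inter> children m a))"
    by (simp add: Int_assoc)
  also have "\<dots> \<le> 1 / (4 * n) * real (card (children m a))"
  proof (rule card_children_line[where l = i])
    fix b assume b: "b \<in> children m a"
    let ?I = "{a i * int (D m i)..<a i * int (D m i) + int (D m i)}"
    have "{k\<in>?I. b(i := k) \<in> X \<inter> children m a} \<subseteq> {k. (r - \<rho>) * ?e - 1 \<le> of_int k \<and> of_int k \<le> (r + \<rho>) * ?e}"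
    proof
      fix k assume "k \<in> {k\<in>?I. b(i := k) \<in> X \<inter> children m a}"
      then obtain x r' where x: "x \<in> cell (Suc m) (b(i := k))" "bad x r'" "b(i := k) \<in> children m a"
        by (auto simp: X_def)
      then have "r' = r" using r cell_child_subset by blast
      then have "\<bar>x $ i - r\<bar> < \<rho>" using x bad_close by simp
      then have "x $ i \<le> r + \<rho>" "r - \<rho> \<le> x $ i" by (auto simp: abs_less_iff)
      then have "x $ i * ?e \<le> (r + \<rho>) * ?e" "(r - \<rho>) * ?e \<le> x $ i * ?e"
        using e'0 by (auto intro: mult_right_mono)
      moreover have "of_int k \<le> x $ i * ?e" "x $ i * ?e \<le> of_int k + 1"
        using x(1) by (auto simp: cell_def dest: spec[where x = i])
      ultimately show "k \<in> {k. (r - \<rho>) * ?e - 1 \<le> of_int k \<and> of_int k \<le> (r + \<rho>) * ?e}" by auto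
    qed
    then have "real (card {k\<in>?I. b(i := k) \<in> X \<inter> children m a}) \<le> (r + \<rho>) * ?e - ((r - \<rho>) * ?e - 1) + 1"
      by (rule card_int_interval) (use n e e'0 in \<open>simp add: \<rho>_def algebra_simps\<close>)
    also have "\<dots> = 1 / (8 * n) * real (D m i) + 2"
      using e n by (simp add: \<rho>_def e' field_simps)
    also have "2 \<le> 1 / (8 * n) * real (D m i)"
      using D_ge n by (simp add: n_def field_simps)
    finally show "real (card {k\<in>?I. b(i := k) \<in> X \<inter> children m a}) \<le> 1 / (4 * n) * real (D m i)"
      by (simp add: field_simps)
  qed
  finally show ?thesis
    unfolding X_def bad_def n_def e_def by (simp add: ex_comm)
qed

end

section \<open>Linear forms and transference\<close>

lemma ldot_diff: "ldot (\<lambda>i. v i - w i) x = ldot v x - ldot w x"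
  by (simp add: ldot_def algebra_simps sum_subtractf)

text \<open>Pigeonhole: the \<open>N\<close> vectors with entries between 0 and \<open>A i\<close>
  have fractional parts falling into \<open>N - 1\<close> intervals, and two in the same interval
  are subtracted. The bound \<open>2 / N\<close> replaces \<open>1 / (N - 1)\<close>.\<close>

lemma dirichlet_linear_form:
  fixes A :: "'n::finite \<Rightarrow> nat" and \<theta> :: "real ^ 'n"
  defines "N \<equiv> (\<Prod>i\<in>UNIV. A i + 1)"
  assumes N: "2 \<le> N"
  obtains v where "v \<noteq> (\<lambda>_. 0)" "\<And>i. \<bar>v i\<bar> \<le> int (A i)" "dist_int (ldot v \<theta>) \<le> 2 / real N"
proof -
  define M where "M = N - 1"
  have M: "0 < M" "real N \<le> 2 * real M" using N by (auto simp: M_def)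
  define S where "S = Pi UNIV (\<lambda>i. {0..int (A i)})"
  define g where "g f = \<lfloor>frac (ldot f \<theta>) * real M\<rfloor>" for f
  have finS: "finite S" using finite_PiE[of UNIV "\<lambda>i. {0..int (A i)}"] by (simp add: S_def PiE_def)
  have cardS: "card S = N"
    using card_PiE[of UNIV "\<lambda>i. {0..int (A i)}"]
    by (simp add: S_def PiE_def N_def nat_add_distrib)
  have g_range: "g ` S \<subseteq> {0..<int M}"
  proof clarify
    fix f
    have "frac (ldot f \<theta>) * real M < 1 * real M"
      using M frac_lt_1 by (intro mult_strict_right_mono) auto
    then show "g f \<in> {0..<int M}" by (simp add: g_def floor_less_iff)
  qed
  have "card (g ` S) < card S"
  proof -
    have "card (g ` S) \<le> card {0..<int M}" using g_range by (rule card_mono[rotated]) simp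
    also have "\<dots> < card S" using N by (simp add: cardS M_def)
    finally show ?thesis .
  qed
  then obtain f f' where f: "f \<in> S" "f' \<in> S" "f \<noteq> f'" "g f = g f'"
    using pigeonhole[of g S] by (auto simp: inj_on_def)
  show ?thesis
  proof (rule that[of "\<lambda>i. f i - f' i"])
    show "(\<lambda>i. f i - f' i) \<noteq> (\<lambda>_. 0)" using f(3) by (auto simp: fun_eq_iff)
    show "\<bar>f i - f' i\<bar> \<le> int (A i)" for i
    proof -
      have "f i \<in> {0..int (A i)}" "f' i \<in> {0..int (A i)}" using f(1,2) by (auto simp: S_def)
      then show ?thesis by auto
    qed
    have "\<bar>frac (ldot f \<theta>) * real M - frac (ldot f' \<theta>) * real M\<bar> \<le> 1"
      using f(4) unfolding g_def by linarith
    then have "\<bar>frac (ldot f \<theta>) - frac (ldot f' \<theta>)\<bar> * real M \<le> 1"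
      by (simp add: abs_mult left_diff_distrib[symmetric])
    then have "\<bar>frac (ldot f \<theta>) - frac (ldot f' \<theta>)\<bar> \<le> 1 / real M"
      using M by (simp add: field_simps)
    also have "\<dots> \<le> 2 / real N" using M N by (simp add: field_simps)
    finally have "\<bar>frac (ldot f \<theta>) - frac (ldot f' \<theta>)\<bar> \<le> 2 / real N" .
    moreover have "dist_int (ldot (\<lambda>i. f i - f' i) \<theta>) \<le> \<bar>frac (ldot f \<theta>) - frac (ldot f' \<theta>)\<bar>"
      using dist_int_le[of "ldot (\<lambda>i. f i - f' i) \<theta>" "\<lfloor>ldot f \<theta>\<rfloor> - \<lfloor>ldot f' \<theta>\<rfloor>"]
      by (simp add: ldot_diff frac_def algebra_simps)
    ultimately show "dist_int (ldot (\<lambda>i. f i - f' i) \<theta>) \<le> 2 / real N" by linarith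
  qed
qed

text \<open>A point \<open>\<eta>\<close> whose linear form \<open>u \<bullet> \<eta>\<close> stays away from the integers cannot be close to
  \<open>q \<theta>\<close> modulo 1 when \<open>q\<close> times the distance of \<open>u \<bullet> \<theta>\<close> to the integers is small.\<close>

lemma dual_form_bound:
  fixes \<theta> \<eta> :: "real ^ 'n::finite"
  shows "dist_int (ldot u \<eta>) \<le> (\<Sum>i\<in>UNIV. \<bar>of_int (u i)\<bar> * dist_int (real q * \<theta> $ i - \<eta> $ i))
           + real q * dist_int (ldot u \<theta>)"
proof -
  have "\<forall>i. \<exists>p::int. dist_int (real q * \<theta> $ i - \<eta> $ i) = \<bar>real q * \<theta> $ i - \<eta> $ i - of_int p\<bar>"
    by (metis dist_int_attained)
  then obtain p :: "'n \<Rightarrow> int" where p: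
    "\<And>i. dist_int (real q * \<theta> $ i - \<eta> $ i) = \<bar>real q * \<theta> $ i - \<eta> $ i - of_int (p i)\<bar>" by metis
  obtain t :: int where t: "dist_int (ldot u \<theta>) = \<bar>ldot u \<theta> - of_int t\<bar>" by (rule dist_int_attained)
  \<comment> \<open>The integer obtained from \<open>u \<bullet> \<eta> = q * (u \<bullet> \<theta>)
    - u \<bullet> (q * \<theta> - \<eta>)\<close> by replacing \<open>u \<bullet> \<theta>\<close>
    and each \<open>q * \<theta> $ i - \<eta> $ i\<close> with its nearest integer.\<close>
  define z where "z = int q * t - (\<Sum>i\<in>UNIV. u i * p i)"
  have "ldot u \<eta> - of_int z = real q * (ldot u \<theta> - of_int t)
      - (\<Sum>i\<in>UNIV. of_int (u i) * (real q * \<theta> $ i - \<eta> $ i - of_int (p i)))"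
    by (simp add: ldot_def z_def algebra_simps sum.distrib sum_subtractf sum_distrib_left)
  then have "\<bar>ldot u \<eta> - of_int z\<bar> \<le> real q * \<bar>ldot u \<theta> - of_int t\<bar>
      + \<bar>\<Sum>i\<in>UNIV. of_int (u i) * (real q * \<theta> $ i - \<eta> $ i - of_int (p i))\<bar>"
    using abs_triangle_ineq4[of "real q * (ldot u \<theta> - of_int t)"] by (simp add: abs_mult)
  also have "\<bar>\<Sum>i\<in>UNIV. of_int (u i) * (real q * \<theta> $ i - \<eta> $ i - of_int (p i))\<bar>
      \<le> (\<Sum>i\<in>UNIV. \<bar>of_int (u i)\<bar> * dist_int (real q * \<theta> $ i - \<eta> $ i))"
    by (rule order_trans[OF sum_abs]) (simp add: abs_mult p)
  finally show ?thesis using dist_int_le[of "ldot u \<eta>" z] by (simp add: t)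
qed

section \<open>Best linear forms in growing boxes and the point built from them\<close>

context box_grid
begin

text \<open>The factor \<open>c < 1\<close> empties the box at level 0 and limits the variation of a
  form from the box of level \<open>m\<close> to at most \<open>c\<close> per direction on a
  level-\<open>m\<close> cell.\<close>

definition form_box :: "real \<Rightarrow> nat \<Rightarrow> ('n \<Rightarrow> int) set" where
  "form_box c m = {v. v \<noteq> (\<lambda>_. 0) \<and> (\<forall>i. \<bar>of_int (v i)\<bar> \<le> c * real (E m i))}"

lemma finite_form_box: "finite (form_box c m)"
proof (rule finite_subset)
  show "form_box c m \<subseteq> Pi UNIV (\<lambda>i. {k. - (c * real (E m i)) \<le> of_int k \<and> of_int k \<le> c * real (E m i)})"
    by (auto simp: form_box_def abs_le_iff minus_le_iff)
  show "finite (Pi UNIV (\<lambda>i. {k::int. - (c * real (E m i)) \<le> of_int k \<and> of_int k \<le> c * real (E m i)}))"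
    using finite_PiE[of UNIV "\<lambda>i. {k::int. - (c * real (E m i)) \<le> of_int k \<and> of_int k \<le> c * real (E m i)}"]
      finite_int_interval by (simp add: PiE_def)
qed

lemma form_box_mono:
  assumes "0 \<le> c" shows "form_box c m \<subseteq> form_box c (Suc m)"
proof -
  have "E m i \<le> E (Suc m) i" for i using D_pos[of m i] by (simp add: E_Suc)
  then have "c * real (E m i) \<le> c * real (E (Suc m) i)" for i
    using assms by (intro mult_left_mono) auto
  then show ?thesis by (auto simp: form_box_def intro: order_trans)
qed

lemma form_box_0:
  assumes "0 \<le> c" "c < 1" shows "form_box c 0 = {}"
proof -
  have "v i = 0" if "\<bar>real_of_int (v i)\<bar> \<le> c" for v :: "'n \<Rightarrow> int" and i using that assms by linarith
  then show ?thesis by (auto simp: form_box_def E_0 fun_eq_iff)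
qed

text \<open>It suffices to control one new linear form per level: a minimiser over a box that already
  lies in the previous box is no better than the form chosen there.\<close>

lemma record_forms:
  fixes \<theta> :: "real ^ 'n"
  assumes c: "0 \<le> c" "c < 1"
  obtains v :: "nat \<Rightarrow> 'n \<Rightarrow> int" where
    "\<And>\<eta> \<delta> m w. (\<And>m. v m \<in> form_box c (Suc m) - form_box c m \<Longrightarrow> \<delta> \<le> dist_int (ldot (v m) \<eta>)) \<Longrightarrow>
      w \<in> form_box c m \<Longrightarrow>
      \<exists>u\<in>form_box c m. dist_int (ldot u \<theta>) \<le> dist_int (ldot w \<theta>) \<and> \<delta> \<le> dist_int (ldot u \<eta>)"
proof -
  \<comment> \<open>For an empty box \<open>v m\<close> is arbitrary; the membership condition
    attached to \<open>far\<close> discards this case.\<close>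
  define v where "v m = arg_min_on (\<lambda>v. dist_int (ldot v \<theta>)) (form_box c (Suc m))" for m
  have v: "v m \<in> form_box c (Suc m)" "dist_int (ldot (v m) \<theta>) \<le> dist_int (ldot w \<theta>)"
    if "w \<in> form_box c (Suc m)" for m w
    using that arg_min_if_finite[OF finite_form_box, of c "Suc m" "\<lambda>v. dist_int (ldot v \<theta>)"]
    by (auto simp: v_def not_less)
  show ?thesis
  proof (rule that[of v])
    fix \<eta> :: "real ^ 'n" and \<delta> :: real and m w
    assume far: "\<And>m. v m \<in> form_box c (Suc m) - form_box c m \<Longrightarrow> \<delta> \<le> dist_int (ldot (v m) \<eta>)"
    show "w \<in> form_box c m \<Longrightarrow>
      \<exists>u\<in>form_box c m. dist_int (ldot u \<theta>) \<le> dist_int (ldot w \<theta>) \<and> \<delta> \<le> dist_int (ldot u \<eta>)"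
    proof (induction m arbitrary: w)
      case 0
      then show ?case using form_box_0[OF c] by simp
    next
      case (Suc m)
      show ?case
      proof (cases "v m \<in> form_box c m")
        case True
        then show ?thesis
          using Suc.IH[OF True] v(2)[OF Suc.prems] form_box_mono[OF c(1), of m] by (meson order_trans subsetD)
      next
        case False
        then show ?thesis using v[OF Suc.prems] far[of m] by blast
      qed
    qed
  qed
qed

text \<open>Dirichlet with \<open>A i\<close> the integer part of \<open>c * E m i\<close>: each
  \<open>A i + 1\<close> is at least \<open>c * E m i\<close>, so the number of vectors is at least
  the product of the sides.\<close>

lemma form_box_dirichlet:
  fixes \<theta> :: "real ^ 'n"
  assumes c: "0 < c" and N: "2 \<le> c ^ CARD('n) * ncells m"
  obtains w where "w \<in> form_box c m" "dist_int (ldot w \<theta>) \<le> 2 / (c ^ CARD('n) * ncells m)"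
proof -
  define A where "A i = nat \<lfloor>c * real (E m i)\<rfloor>" for i
  have cE: "0 \<le> c * real (E m i)" for i using c by simp
  have A: "real (A i) \<le> c * real (E m i)" "c * real (E m i) \<le> real (A i + 1)" for i
    using cE[of i] by (simp_all add: A_def)  linarith
  have "c ^ CARD('n) * ncells m = (\<Prod>i\<in>UNIV. c * real (E m i))"
    by (simp add: ncells_def prod.distrib)
  also have "\<dots> \<le> (\<Prod>i\<in>UNIV. real (A i + 1))" by (intro prod_mono) (use A(2) cE in auto)
  finally have le: "c ^ CARD('n) * ncells m \<le> real (\<Prod>i\<in>UNIV. A i + 1)" by simp
  then have "2 \<le> (\<Prod>i\<in>UNIV. A i + 1)" using N by linarith
  then obtain v where v: "v \<noteq> (\<lambda>_. 0)" "\<And>i. \<bar>v i\<bar> \<le> int (A i)"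
      "dist_int (ldot v \<theta>) \<le> 2 / real (\<Prod>i\<in>UNIV. A i + 1)"
    using dirichlet_linear_form[of A \<theta>] by blast
  show ?thesis
  proof (rule that[of v])
    have "\<bar>real_of_int (v i)\<bar> \<le> c * real (E m i)" for i
      using v(2)[of i] A(1)[of i] by linarith
    then show "v \<in> form_box c m" using v(1) by (simp add: form_box_def)
    have "2 / real (\<Prod>i\<in>UNIV. A i + 1) \<le> 2 / (c ^ CARD('n) * ncells m)"
      using le N by (intro divide_left_mono) auto
    then show "dist_int (ldot v \<theta>) \<le> 2 / (c ^ CARD('n) * ncells m)" using v(3) by linarith
  qed
qed

text \<open>At each level the new form loses at most a quarter of the children and the rationals of
  all coordinates together another quarter, so half survive and a branch avoiding the cells that
  meet any \<open>U k\<close> exists. Its limit point inherits all these exclusions because it lies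
  in every cell of the branch.\<close>

lemma point_avoiding_obstacles:
  fixes c \<epsilon> d :: real and v :: "nat \<Rightarrow> 'n \<Rightarrow> int" and U :: "nat \<Rightarrow> (real ^ 'n) set"
  assumes c: "0 < c" "c \<le> 1 / (8 * (2 * real CARD('n) + 7))"
    and D_ge: "\<And>m i. 8 * (4 * real CARD('n) + 2) \<le> real (D m i)"
    and \<epsilon>: "0 < \<epsilon>" "4 * d * \<epsilon> \<le> 1 / (16 * real CARD('n))" and d: "0 < d"
    and fin: "\<And>k. finite {b. cell (lev k) b \<inter> U k \<noteq> {}}"
    and weight: "(\<Sum>k. ennreal (2 ^ lev k / ncells (lev k) * real (card {b. cell (lev k) b \<inter> U k \<noteq> {}}))) < 1"
  obtains \<eta> where "\<And>k. \<eta> \<notin> U k"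
    "\<And>m. v m \<in> form_box c (Suc m) - form_box c m \<Longrightarrow> c\<^sup>2 \<le> dist_int (ldot (v m) \<eta>)"
    "\<And>m i q p. 0 < q \<Longrightarrow> 4 * of_int q ^ 2 < real (E m i) \<Longrightarrow> real (E m i) \<le> 4 * d * of_int q ^ 2
      \<Longrightarrow> \<epsilon> / of_int q ^ 2 \<le> \<bar>\<eta> $ i - of_int p / of_int q\<bar>"
proof -
  define n where "n = real CARD('n)"
  have n: "1 \<le> n" by (simp add: n_def Suc_le_eq)
  define X where "X m = (if v m \<in> form_box c (Suc m) - form_box c m
      then {b. \<exists>x\<in>cell (Suc m) b. \<exists>p::int. \<bar>ldot (v m) x - of_int p\<bar> < c\<^sup>2} else {})" for m
  define Y where "Y m i = {b. \<exists>x\<in>cell (Suc m) b. \<exists>q p::int. 0 < q \<and> 4 * of_int q ^ 2 < real (E m i) \<and>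
      real (E m i) \<le> 4 * d * of_int q ^ 2 \<and> \<bar>x $ i - of_int p / of_int q\<bar> < \<epsilon> / of_int q ^ 2}" for m i
  define G where "G m b \<longleftrightarrow> b \<notin> X m \<and> (\<forall>i. b \<notin> Y m i)" for m b
  have cX: "real (card (X m \<inter> children m a)) \<le> 1 / 4 * real (card (children m a))" for m a
  proof (cases "v m \<in> form_box c (Suc m) - form_box c m")
    case True
    then have "\<And>i. \<bar>of_int (v m i)\<bar> \<le> c * real (E (Suc m) i)" "\<not> (\<forall>i. \<bar>of_int (v m i)\<bar> \<le> c * real (E m i))"
      by (auto simp: form_box_def)
    from card_strip_children[OF c D_ge this] show ?thesis using True by (simp add: X_def)
  qed (auto simp: X_def)
  have cY: "real (card (Y m i \<inter> children m a)) \<le> 1 / (4 * n) * real (card (children m a))" for m i a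
    unfolding Y_def n_def by (rule card_rational_children[OF D_ge \<epsilon> d])
  have good: "real (card (children m a)) \<le> 2 * real (card {b\<in>children m a. G m b})" for m a
  proof -
    let ?C = "children m a"
    let ?G = "{b\<in>?C. G m b}"
    have "card ?C \<le> card (?G \<union> ((X m \<inter> ?C) \<union> (\<Union>i. Y m i \<inter> ?C)))"
      using finite_children by (intro card_mono) (auto simp: G_def)
    also have "\<dots> \<le> card ?G + (card (X m \<inter> ?C) + card (\<Union>i. Y m i \<inter> ?C))"
      by (intro order_trans[OF card_Un_le] add_left_mono card_Un_le)
    also have "card (\<Union>i. Y m i \<inter> ?C) \<le> (\<Sum>i\<in>UNIV. card (Y m i \<inter> ?C))"
      by (intro card_UN_le) simp
    finally have "real (card ?C) \<le> real (card ?G) + (real (card (X m \<inter> ?C)) + (\<Sum>i\<in>UNIV. real (card (Y m i \<inter> ?C))))"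
      by (simp flip: of_nat_sum of_nat_add)
    also have "(\<Sum>i\<in>UNIV. real (card (Y m i \<inter> ?C))) \<le> n * (1 / (4 * n) * real (card ?C))"
      unfolding n_def using cY[unfolded n_def] by (intro sum_bounded_above) auto
    also have "\<dots> = 1 / 4 * real (card ?C)" using n by simp
    finally show ?thesis using cX[of m a] by linarith
  qed
  obtain a where a: "\<And>m. a (Suc m) \<in> children m (a m)" "\<And>m. G m (a (Suc m))"
      "\<And>k. a (lev k) \<notin> {b. cell (lev k) b \<inter> U k \<noteq> {}}"
    using branch_avoiding_obstacles[of "\<lambda>m _ b. G m b", OF good fin weight] by blast
  obtain \<eta> where \<eta>: "\<And>m. \<eta> \<in> cell m (a m)" using nested_cells_point a(1) by blast
  show ?thesis
  proof (rule that[of \<eta>])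
    show "\<eta> \<notin> U k" for k using a(3)[of k] \<eta>[of "lev k"] by blast
    show "c\<^sup>2 \<le> dist_int (ldot (v m) \<eta>)" if "v m \<in> form_box c (Suc m) - form_box c m" for m
    proof (rule dist_int_ge)
      fix p :: int
      have "a (Suc m) \<notin> X m" using a(2)[of m] by (simp add: G_def)
      then show "c\<^sup>2 \<le> \<bar>ldot (v m) \<eta> - of_int p\<bar>" using that \<eta>[of "Suc m"] by (auto simp: X_def not_less)
    qed
    show "\<epsilon> / of_int q ^ 2 \<le> \<bar>\<eta> $ i - of_int p / of_int q\<bar>"
      if "0 < q" "4 * of_int q ^ 2 < real (E m i)" "real (E m i) \<le> 4 * d * of_int q ^ 2" for m i and q p :: int
    proof -
      have "a (Suc m) \<notin> Y m i" using a(2)[of m] by (simp add: G_def)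
      then show ?thesis using that \<eta>[of "Suc m"] unfolding Y_def by (blast intro: leI)
    qed
  qed
qed

text \<open>Each \<open>q\<close> is handled at the first level with
  \<open>4 * q\<^sup>2 < E m i\<close>. One level multiplies \<open>E\<close> by at most
  \<open>d\<close>, so there also \<open>E m i \<le> 4 * d * q\<^sup>2\<close>, and
  \<open>far\<close> applies.\<close>

lemma coord_badI:
  fixes d \<epsilon> :: real
  assumes D_ge: "\<And>m. 2 \<le> D m i" and D_le: "\<And>m. real (D m i) \<le> d" and \<epsilon>: "0 < \<epsilon>"
    and far: "\<And>m q p. 0 < q \<Longrightarrow> 4 * of_int q ^ 2 < real (E m i) \<Longrightarrow> real (E m i) \<le> 4 * d * of_int q ^ 2
      \<Longrightarrow> \<epsilon> / of_int q ^ 2 \<le> \<bar>\<eta> $ i - of_int p / of_int q\<bar>"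
  shows "\<eta> \<in> coord_bad i"
proof -
  have "\<epsilon> \<le> real q * dist_int (real q * \<eta> $ i)" if q: "1 \<le> q" for q :: nat
  proof -
    have "4 * q ^ 2 < 2 ^ (4 * q ^ 2)" by (rule less_exp)
    also have "\<dots> \<le> E (4 * q ^ 2) i" by (rule E_ge_power[OF D_ge])
    finally have ex: "\<exists>m. 4 * q ^ 2 < E m i" by blast
    define m where "m = (LEAST m. 4 * q ^ 2 < E m i)"
    have m: "4 * q ^ 2 < E m i" unfolding m_def using ex by (rule LeastI_ex)
    have "m \<noteq> 0"
    proof
      assume "m = 0"
      then have "4 * q ^ 2 < 1" using m by (simp only: E_0)
      then show False using q by simp
    qed
    then obtain k where k: "m = Suc k" by (cases m) auto
    have "\<not> 4 * q ^ 2 < E k i" using not_less_Least[of k "\<lambda>m. 4 * q ^ 2 < E m i"] k m_def by simp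
    then have "real (E k i) \<le> 4 * real q ^ 2"
      by (metis not_less of_nat_le_iff of_nat_mult of_nat_numeral of_nat_power)
    then have "real (E k i) * real (D k i) \<le> 4 * real q ^ 2 * d"
      using D_le[of k] by (intro mult_mono) auto
    then have E_le: "real (E m i) \<le> 4 * d * of_int (int q) ^ 2" by (simp add: k E_Suc algebra_simps)
    have E_gt: "4 * of_int (int q) ^ 2 < real (E m i)"
      using m by (metis of_int_of_nat_eq of_nat_less_iff of_nat_mult of_nat_numeral of_nat_power)
    obtain p :: int where p: "dist_int (real q * \<eta> $ i) = \<bar>real q * \<eta> $ i - of_int p\<bar>"
      by (rule dist_int_attained)
    have qpos: "0 < real q" using q by simp
    have "\<epsilon> / real q ^ 2 \<le> \<bar>\<eta> $ i - of_int p / real q\<bar>"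
      using far[OF _ E_gt E_le, of p] q by simp
    then have "\<epsilon> \<le> real q ^ 2 * \<bar>\<eta> $ i - of_int p / real q\<bar>"
      using qpos by (simp add: field_simps)
    also have "\<dots> = real q * \<bar>real q * (\<eta> $ i - of_int p / real q)\<bar>"
      using qpos by (simp add: abs_mult power2_eq_square)
    also have "real q * (\<eta> $ i - of_int p / real q) = real q * \<eta> $ i - of_int p"
      using qpos by (simp add: field_simps)
    finally show ?thesis by (simp add: p)
  qed
  then have "\<epsilon> \<le> (INF q\<in>{1::nat..}. real q * dist_int (real q * \<eta> $ i))"
    by (intro cINF_greatest) auto
  then show ?thesis using \<epsilon> by (simp add: coord_bad_def)
qed

end

section \<open>Obstacles from covers\<close>

context box_grid
begin

text \<open>Relative to a fixed point of \<open>U\<close>, each index ranges over a real interval of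
  length \<open>2 * d * E m i + 1\<close>; the shift by 1 accounts for cells that start before
  it.\<close>

lemma cells_meeting_set:
  assumes ne: "U \<noteq> {}" and diff: "\<And>x y i. x \<in> U \<Longrightarrow> y \<in> U \<Longrightarrow> \<bar>x $ i - y $ i\<bar> \<le> d"
  shows "finite {b. cell m b \<inter> U \<noteq> {}}"
    and "real (card {b. cell m b \<inter> U \<noteq> {}}) \<le> (\<Prod>i\<in>UNIV. 2 * d * real (E m i) + 2)"
proof -
  obtain y where y: "y \<in> U" using ne by auto
  have d: "0 \<le> d" using diff[OF y y] by simp
  define S where "S i = {k::int. (y $ i - d) * real (E m i) - 1 \<le> of_int k \<and> of_int k \<le> (y $ i + d) * real (E m i)}" for i
  have sub: "{b. cell m b \<inter> U \<noteq> {}} \<subseteq> Pi UNIV S"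
  proof
    fix b assume "b \<in> {b. cell m b \<inter> U \<noteq> {}}"
    then obtain x where x: "x \<in> cell m b" "x \<in> U" by blast
    have "b i \<in> S i" for i
    proof -
      have "y $ i - d \<le> x $ i" "x $ i \<le> y $ i + d" using diff[OF x(2) y, of i] by (auto simp: abs_le_iff)
      then have "(y $ i - d) * real (E m i) \<le> x $ i * real (E m i)" "x $ i * real (E m i) \<le> (y $ i + d) * real (E m i)"
        by (auto intro: mult_right_mono)
      moreover have "of_int (b i) \<le> x $ i * real (E m i)" "x $ i * real (E m i) \<le> of_int (b i) + 1"
        using x(1) by (auto simp: cell_def)
      ultimately show ?thesis by (simp add: S_def)
    qed
    then show "b \<in> Pi UNIV S" by simp
  qed
  have finS: "finite (S i)" for i unfolding S_def by (rule finite_int_interval)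
  have fin: "finite (Pi UNIV S)" using finite_PiE[of UNIV S] finS by (simp add: PiE_def)
  show "finite {b. cell m b \<inter> U \<noteq> {}}" using sub fin by (rule finite_subset)
  have "card {b. cell m b \<inter> U \<noteq> {}} \<le> card (Pi UNIV S)" using fin sub by (rule card_mono)
  also have "card (Pi UNIV S) = (\<Prod>i\<in>UNIV. card (S i))" using card_PiE[of UNIV S] by (simp add: PiE_def)
  finally have "real (card {b. cell m b \<inter> U \<noteq> {}}) \<le> (\<Prod>i\<in>UNIV. real (card (S i)))"
    by (simp flip: of_nat_prod)
  also have "\<dots> \<le> (\<Prod>i\<in>UNIV. 2 * d * real (E m i) + 2)"
  proof (rule prod_mono, safe)
    fix i
    have "real (card (S i)) \<le> (y $ i + d) * real (E m i) - ((y $ i - d) * real (E m i) - 1) + 1"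
      by (rule card_int_interval) (use d in \<open>auto simp: S_def algebra_simps intro: add_nonneg_nonneg\<close>)
    then show "real (card (S i)) \<le> 2 * d * real (E m i) + 2" by (simp add: algebra_simps)
  qed simp
  finally show "real (card {b. cell m b \<inter> U \<noteq> {}}) \<le> (\<Prod>i\<in>UNIV. 2 * d * real (E m i) + 2)" .
qed

text \<open>The level is the first at which all sides of a cell are at most \<open>d\<close>. One
  level earlier some side is still longer, and \<open>grow\<close> turns this into a bound on
  \<open>2 ^ m\<close>: the loss of a factor 2 per level costs only the power \<open>t\<close> of
  \<open>2 / d\<close>.\<close>

lemma level_for_diameter:
  fixes d t :: real
  assumes d: "0 < d" "d \<le> 1" and t: "0 < t" and D_ge: "\<And>m i. 2 \<le> D m i"
    and grow: "\<And>k i. 2 ^ k \<le> (2 * real (E k i)) powr t"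
  obtains m where "\<And>i. 1 \<le> d * real (E m i)" "2 ^ m \<le> 2 * (2 / d) powr t"
proof -
  have ex: "\<exists>m. \<forall>i. 1 \<le> d * real (E m i)"
  proof -
    obtain m where m: "1 / d < 2 ^ m" using real_arch_pow[of 2 "1 / d"] by auto
    have "1 \<le> d * real (E m i)" for i
    proof -
      have "real (2 ^ m) \<le> real (E m i)" using E_ge_power[OF D_ge] by (simp only: of_nat_le_iff)
      then have "1 / d \<le> real (E m i)" using m unfolding of_nat_power of_nat_numeral by linarith
      then show ?thesis using d by (simp add: field_simps)
    qed
    then show ?thesis by blast
  qed
  define m where "m = (LEAST m. \<forall>i. 1 \<le> d * real (E m i))"
  have m: "\<forall>i. 1 \<le> d * real (E m i)" unfolding m_def using ex by (rule LeastI_ex)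
  have "2 ^ m \<le> 2 * (2 / d) powr t"
  proof (cases m)
    case 0
    have "1 \<le> 2 / d" using d by simp
    then have "1 \<le> (2 / d) powr t" using t by (simp add: ge_one_powr_ge_zero)
    then show ?thesis using 0 by simp
  next
    case (Suc k)
    have "\<not> (\<forall>i. 1 \<le> d * real (E k i))"
      using not_less_Least[of k "\<lambda>m. \<forall>i. 1 \<le> d * real (E m i)"] Suc m_def by simp
    then obtain i where "d * real (E k i) < 1" by (auto simp: not_le)
    then have "2 * real (E k i) \<le> 2 / d" using d by (simp add: field_simps)
    then have "(2 * real (E k i)) powr t \<le> (2 / d) powr t" using t by (intro powr_mono2) auto
    then have "2 ^ k \<le> (2 / d) powr t" using grow[of k i] by linarith
    then show ?thesis using Suc by simp
  qed
  then show ?thesis using that m by blast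
qed

text \<open>At the level matched to \<open>d\<close>, the set meets at most
  \<open>(4 * d) ^ n * ncells m\<close> cells. With \<open>t = n - s\<close> the factor
  \<open>2 ^ m\<close> contributes \<open>(2 / d) powr (n - s)\<close>, which leaves
  \<open>d powr s\<close> times a constant.\<close>

lemma obstacle_weight_bound:
  fixes d s :: real and U :: "(real ^ 'n) set"
  assumes d: "0 < d" "d \<le> 1" and s: "0 \<le> s" "s < real CARD('n)"
    and D_ge: "\<And>m i. 2 \<le> D m i"
    and grow: "\<And>k i. 2 ^ k \<le> (2 * real (E k i)) powr (real CARD('n) - s)"
    and diff: "\<And>x y i. x \<in> U \<Longrightarrow> y \<in> U \<Longrightarrow> \<bar>x $ i - y $ i\<bar> \<le> d"
  obtains m where "finite {b. cell m b \<inter> U \<noteq> {}}"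
    "2 ^ m / ncells m * real (card {b. cell m b \<inter> U \<noteq> {}}) \<le> 2 * 8 ^ CARD('n) * d powr s"
proof (cases "U = {}")
  case True
  then show ?thesis using that[of 0] by simp
next
  case False
  define n where "n = CARD('n)"
  obtain m where m: "\<And>i. 1 \<le> d * real (E m i)" "2 ^ m \<le> 2 * (2 / d) powr (real CARD('n) - s)"
    using level_for_diameter[OF d _ D_ge grow] s by auto
  have "real (card {b. cell m b \<inter> U \<noteq> {}}) \<le> (\<Prod>i\<in>UNIV. 2 * d * real (E m i) + 2)"
    by (rule cells_meeting_set(2)[OF False diff])
  also have "\<dots> \<le> (\<Prod>i\<in>UNIV. (4 * d) * real (E m i))"
    using m(1) d by (intro prod_mono) (auto simp: algebra_simps intro!: add_nonneg_nonneg)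
  also have "\<dots> = (4 * d) ^ n * ncells m" by (simp add: prod.distrib ncells_def n_def)
  finally have "2 ^ m / ncells m * real (card {b. cell m b \<inter> U \<noteq> {}}) \<le> 2 ^ m / ncells m * ((4 * d) ^ n * ncells m)"
    using ncells_pos[of m] by (intro mult_left_mono) auto
  also have "\<dots> = 2 ^ m * (4 * d) ^ n" using ncells_pos[of m] by simp
  also have "\<dots> \<le> 2 * (2 / d) powr (real n - s) * (4 * d) ^ n"
    using m(2) d by (intro mult_right_mono) (auto simp: n_def)
  also have "\<dots> = 2 * 4 ^ n * 2 powr (real n - s) * d powr s"
  proof -
    have "(2 / d) powr (real n - s) * d ^ n = 2 powr (real n - s) * d powr s"
      using d by (simp add: powr_divide powr_realpow[symmetric] powr_diff field_simps)
    then show ?thesis by (simp add: power_mult_distrib)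
  qed
  also have "\<dots> \<le> 2 * 4 ^ n * 2 ^ n * d powr s"
    using s d powr_mono[of "real n - s" "real n" 2] by (intro mult_right_mono mult_left_mono) (auto simp: powr_realpow)
  also have "\<dots> = 2 * 8 ^ n * d powr s" by (simp add: power_mult_distrib[symmetric])
  finally show ?thesis using that[of m] cells_meeting_set(1)[OF False diff] by (simp add: n_def)
qed

text \<open>For given \<open>q\<close> a level is chosen with \<open>R ^ m\<close> comparable to
  \<open>q\<close>. Dirichlet and \<open>forms\<close> give \<open>u\<close> with \<open>q\<close>
  times the distance of \<open>u \<bullet> \<theta>\<close> to the integers at most
  \<open>c\<^sup>2 / 2\<close>, while \<open>u \<bullet> \<eta>\<close> is at distance at least
  \<open>c\<^sup>2\<close>. The coordinate terms must supply the missing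
  \<open>c\<^sup>2 / 2\<close>, and each \<open>\<bar>u i\<bar>\<close> is at most
  \<open>K * q powr (j $ i)\<close>.\<close>

lemma twisted_badI:
  fixes \<theta> \<eta> j :: "real ^ 'n" and c R :: real
  assumes c: "0 < c" "c \<le> 1" and R: "1 < R"
    and j: "\<And>i. 0 < j $ i" "\<And>i. j $ i \<le> 1"
    and E_le: "\<And>m i. real (E m i) \<le> (R ^ m) powr (j $ i)"
    and ncells_ge: "\<And>m. R ^ m \<le> 2 ^ CARD('n) * ncells m"
    and forms: "\<And>m w. w \<in> form_box c m \<Longrightarrow>
      \<exists>u\<in>form_box c m. dist_int (ldot u \<theta>) \<le> dist_int (ldot w \<theta>) \<and> c\<^sup>2 \<le> dist_int (ldot u \<eta>)"
  shows "\<eta> \<in> twisted_bad \<theta> j"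
proof -
  define n where "n = CARD('n)"
  \<comment> \<open>\<open>C / R ^ m\<close> bounds the Dirichlet error at level \<open>m\<close>,
    and \<open>K\<close> is the constant in \<open>R ^ m \<le> K * q\<close> that the minimality of
    the level yields.\<close>
  define C where "C = 2 * (2 / c) ^ n"
  define K where "K = 2 * C * R / c\<^sup>2"
  have c2: "0 < c\<^sup>2" "c\<^sup>2 \<le> 1" using c by (auto simp: power_le_one)
  have C: "2 \<le> C" using c by (simp add: C_def one_le_power)
  have K: "1 \<le> K"
  proof -
    have "1 * 1 \<le> (2 * C) * R" using C R by (intro mult_mono) auto
    then show ?thesis using c2 by (simp add: K_def le_divide_eq)
  qed
  have main: "c\<^sup>2 / (2 * real n * K) \<le> (MAX i. real q powr (j $ i) * dist_int (real q * \<theta> $ i - \<eta> $ i))"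
    if q: "1 \<le> q" for q :: nat
  proof -
    let ?t = "\<lambda>i. real q powr (j $ i) * dist_int (real q * \<theta> $ i - \<eta> $ i)"
    have q1: "1 \<le> real q" using q by simp
    have ex: "\<exists>m. real q * C \<le> c\<^sup>2 / 2 * R ^ m"
    proof -
      obtain m where "real q * C * 2 / c\<^sup>2 < R ^ m" using real_arch_pow[OF R] by blast
      then show ?thesis using c2 by (intro exI[of _ m]) (simp add: field_simps)
    qed
    \<comment> \<open>The first level at which the Dirichlet error, multiplied by \<open>q\<close>,
      is at most \<open>c\<^sup>2 / 2\<close>.\<close>
    define m where "m = (LEAST m. real q * C \<le> c\<^sup>2 / 2 * R ^ m)"
    have m: "real q * C \<le> c\<^sup>2 / 2 * R ^ m" unfolding m_def using ex by (rule LeastI_ex)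
    have qC: "2 \<le> real q * C" using mult_mono[of 1 "real q" 2 C] q1 C by simp
    have "m \<noteq> 0"
    proof
      assume "m = 0"
      then have "real q * C \<le> c\<^sup>2 / 2" using m by simp
      then show False using qC c2 by linarith
    qed
    then obtain k where k: "m = Suc k" by (cases m) auto
    have "\<not> real q * C \<le> c\<^sup>2 / 2 * R ^ k"
      using not_less_Least[of k "\<lambda>m. real q * C \<le> c\<^sup>2 / 2 * R ^ m"] k m_def by simp
    then have "R ^ k \<le> 2 * C * real q / c\<^sup>2" using c2 by (simp add: field_simps)
    then have "R ^ m \<le> R * (2 * C * real q / c\<^sup>2)" unfolding k power_Suc using R by (intro mult_left_mono) auto
    then have RK: "R ^ m \<le> K * real q" by (simp add: K_def field_simps)
    have Rm: "0 < R ^ m" using R by simp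
    have N_ge: "R ^ m * (c / 2) ^ n \<le> c ^ n * ncells m"
      using ncells_ge[of m] c by (simp add: power_divide n_def field_simps)
    have C_inv: "(c / 2) ^ n = 2 / C" using c by (simp add: C_def power_divide)
    have N_large: "4 / c\<^sup>2 \<le> R ^ m * (c / 2) ^ n"
    proof -
      have "1 * C \<le> real q * C" using q1 C by (intro mult_right_mono) auto
      then have "C \<le> c\<^sup>2 / 2 * R ^ m" using m by linarith
      then show ?thesis unfolding C_inv using c2 C by (simp add: field_simps)
    qed
    have "4 \<le> 4 / c\<^sup>2" using c2 by (simp add: le_divide_eq)
    then have N2: "2 \<le> c ^ CARD('n) * ncells m" using N_ge N_large by (simp add: n_def)
    obtain w where w: "w \<in> form_box c m" "dist_int (ldot w \<theta>) \<le> 2 / (c ^ CARD('n) * ncells m)"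
      using form_box_dirichlet[OF c(1) N2] by blast
    obtain u where u: "u \<in> form_box c m" "dist_int (ldot u \<theta>) \<le> dist_int (ldot w \<theta>)" "c\<^sup>2 \<le> dist_int (ldot u \<eta>)"
      using forms[OF w(1)] by blast
    have "2 / (c ^ n * ncells m) \<le> 2 / (R ^ m * (c / 2) ^ n)"
      using N_ge Rm c ncells_pos[of m] by (intro divide_left_mono) auto
    also have "\<dots> = C / R ^ m" using C by (simp add: C_inv)
    finally have u_le: "dist_int (ldot u \<theta>) \<le> C / R ^ m" using u(2) w(2) by (simp add: n_def)
    have "real q * dist_int (ldot u \<theta>) \<le> real q * (C / R ^ m)" using u_le by (intro mult_left_mono) auto
    also have "\<dots> \<le> c\<^sup>2 / 2" using m Rm by (simp add: field_simps)
    finally have half: "c\<^sup>2 / 2 \<le> (\<Sum>i\<in>UNIV. \<bar>of_int (u i)\<bar> * dist_int (real q * \<theta> $ i - \<eta> $ i))"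
      using dual_form_bound[of u \<eta> q \<theta>] u(3) by linarith
    have term_le: "\<bar>of_int (u i)\<bar> * dist_int (real q * \<theta> $ i - \<eta> $ i) \<le> K * (MAX i. ?t i)" for i
    proof -
      have "\<bar>of_int (u i)\<bar> \<le> c * real (E m i)" using u(1) by (simp add: form_box_def)
      also have "\<dots> \<le> real (E m i)" using c by (simp add: mult_left_le_one_le)
      also have "\<dots> \<le> (R ^ m) powr (j $ i)" by (rule E_le)
      also have "\<dots> \<le> (K * real q) powr (j $ i)" using RK Rm j(1)[of i] by (intro powr_mono2) auto
      also have "\<dots> = K powr (j $ i) * real q powr (j $ i)" using K by (simp add: powr_mult)
      also have "\<dots> \<le> K * real q powr (j $ i)"
        using powr_mono[of "j $ i" 1 K] K j(2)[of i] by (intro mult_right_mono) auto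
      finally have "\<bar>of_int (u i)\<bar> * dist_int (real q * \<theta> $ i - \<eta> $ i)
          \<le> (K * real q powr (j $ i)) * dist_int (real q * \<theta> $ i - \<eta> $ i)"
        by (intro mult_right_mono dist_int_nonneg)
      also have "\<dots> = K * ?t i" by simp
      also have "\<dots> \<le> K * (MAX i. ?t i)" using K by (intro mult_left_mono Max_ge) auto
      finally show ?thesis .
    qed
    have "c\<^sup>2 / 2 \<le> real n * (K * (MAX i. ?t i))"
      using half sum_bounded_above[of UNIV "\<lambda>i. \<bar>of_int (u i)\<bar> * dist_int (real q * \<theta> $ i - \<eta> $ i)", OF term_le]
      by (simp add: n_def)
    then show ?thesis using K by (simp add: n_def field_simps)
  qed
  have "c\<^sup>2 / (2 * real n * K) \<le> (INF q\<in>{1::nat..}. MAX i. real q powr (j $ i) * dist_int (real q * \<theta> $ i - \<eta> $ i))"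
    by (intro cINF_greatest) (use main in auto)
  moreover have "0 < c\<^sup>2 / (2 * real n * K)" using c2 K by (simp add: n_def)
  ultimately show ?thesis by (simp add: twisted_bad_def)
qed

end

section \<open>Hausdorff dimension\<close>

text \<open>The grid is \<open>E m i = 2 ^ e m i\<close> with \<open>e m i\<close> the integer part
  of \<open>m * L * j $ i\<close>, and \<open>R = 2 ^ L\<close>. Powers of 2 make successive levels
  divide each other, and rounding costs at most a factor 2 per coordinate, whence
  \<open>2 ^ CARD('n)\<close>.\<close>

lemma weighted_dyadic_grid:
  fixes j :: "real ^ 'n" and B t :: real
  assumes j: "\<And>i. j $ i > 0" "(\<Sum>i\<in>UNIV. j $ i) = 1" and t: "0 < t"
  obtains E D :: "nat \<Rightarrow> 'n \<Rightarrow> nat" and R d :: real where "box_grid E D"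
    "\<And>m i. B \<le> real (D m i)" "\<And>m i. real (D m i) \<le> d" "1 < R"
    "\<And>m i. real (E m i) \<le> (R ^ m) powr (j $ i)"
    "\<And>m. R ^ m \<le> 2 ^ CARD('n) * (\<Prod>i\<in>UNIV. real (E m i))"
    "\<And>m i. 2 ^ m \<le> (2 * real (E m i)) powr t"
proof -
  have j1: "j $ i \<le> 1" for i
    using member_le_sum[of i UNIV "\<lambda>i. j $ i"] j by (simp add: less_imp_le)
  obtain B' :: nat where B': "B < 2 ^ B'" using real_arch_pow[of 2 B] by auto
  \<comment> \<open>\<open>B'\<close> makes each subdivision finer than \<open>B\<close>, the 1
    absorbs the rounding of the exponents, and \<open>1 / t\<close> ensures
    \<open>m \<le> t * (m * L * j $ i)\<close>, which gives the growth condition.\<close>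
  obtain L :: nat where L: "Max (range (\<lambda>i. (real B' + 1 + 1 / t) / (j $ i))) < real L"
    using reals_Archimedean2 by blast
  have Lj: "real B' + 1 + 1 / t \<le> real L * j $ i" for i
  proof -
    have "(real B' + 1 + 1 / t) / (j $ i) \<le> Max (range (\<lambda>i. (real B' + 1 + 1 / t) / (j $ i)))"
      by (intro Max_ge) auto
    then have "(real B' + 1 + 1 / t) / (j $ i) < real L" using L by linarith
    then show ?thesis using j(1)[of i] by (simp add: field_simps)
  qed
  have tpos: "0 < 1 / t" using t by simp
  have L0: "0 < L"
  proof (rule ccontr)
    assume "\<not> 0 < L"
    then show False using Lj[of undefined] tpos by simp
  qed
  define x where "x m i = real m * (real L * j $ i)" for m i
  have x0: "0 \<le> x m i" for m i using j(1)[of i] by (simp add: x_def)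
  define e where "e m i = nat \<lfloor>x m i\<rfloor>" for m i
  have e: "real (e m i) \<le> x m i" "x m i < real (e m i) + 1" for m i
    using x0[of m i] by (simp_all add: e_def)
  have x_Suc: "x (Suc m) i = x m i + real L * j $ i" for m i
    by (simp add: x_def algebra_simps)
  have diff: "e m i + B' \<le> e (Suc m) i" "e (Suc m) i \<le> e m i + (L + 1)" for m i
  proof -
    have "real L * j $ i \<le> real L" using j1[of i] by (simp add: mult_left_le)
    then have "real (e (Suc m) i) < real (e m i + (L + 2))"
      using e[of m i] e[of "Suc m" i] x_Suc[of m i] by simp
    then show "e (Suc m) i \<le> e m i + (L + 1)" by simp
    have "real (e m i) + real B' < real (e (Suc m) i) + 1"
      using e[of m i] e[of "Suc m" i] x_Suc[of m i] Lj[of i] tpos by linarith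
    then show "e m i + B' \<le> e (Suc m) i" by linarith
  qed
  define E where "E m i = (2::nat) ^ e m i" for m i
  define D where "D m i = (2::nat) ^ (e (Suc m) i - e m i)" for m i
  have R: "((2::real) ^ L) ^ m = 2 powr (real m * real L)" for m
    by (simp add: powr_realpow[symmetric] powr_powr mult.commute)
  have twoE: "2 powr x m i \<le> 2 * real (E m i)" for m i
  proof -
    have "2 powr x m i \<le> 2 powr (real (e m i) + 1)" using e(2)[of m i] by (intro powr_mono) auto
    also have "\<dots> = 2 * real (E m i)" by (simp add: E_def powr_add powr_realpow)
    finally show ?thesis .
  qed
  show ?thesis
  proof (rule that[of E D "2 ^ (L + 1)" "2 ^ L"])
    show "box_grid E D"
    proof
      show "E 0 i = 1" for i by (simp add: E_def e_def x_def)
      show "E (Suc m) i = E m i * D m i" for m i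
        using diff(1)[of m i] by (simp add: E_def D_def power_add[symmetric])
      show "0 < D m i" for m i by (simp add: D_def)
    qed
    show "B \<le> real (D m i)" for m i
    proof -
      have "(2::real) ^ B' \<le> 2 ^ (e (Suc m) i - e m i)" using diff(1)[of m i] by (intro power_increasing) auto
      then have "B \<le> 2 ^ (e (Suc m) i - e m i)" using B' by linarith
      then show ?thesis by (simp add: D_def)
    qed
    show "real (D m i) \<le> 2 ^ (L + 1)" for m i
    proof -
      have "(2::real) ^ (e (Suc m) i - e m i) \<le> 2 ^ (L + 1)" using diff(2)[of m i] by (intro power_increasing) auto
      then show ?thesis by (simp add: D_def)
    qed
    show "1 < (2::real) ^ L" using L0 by simp
    show "real (E m i) \<le> ((2 ^ L) ^ m) powr (j $ i)" for m i
    proof -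
      have "real (E m i) = 2 powr real (e m i)" by (simp add: E_def powr_realpow)
      also have "\<dots> \<le> 2 powr x m i" using e(1)[of m i] by (intro powr_mono) auto
      finally show ?thesis by (simp add: R powr_powr x_def mult.assoc)
    qed
    show "(2 ^ L) ^ m \<le> 2 ^ CARD('n) * (\<Prod>i\<in>UNIV. real (E m i))" for m
    proof -
      have "(2 ^ L) ^ m = 2 powr (\<Sum>i\<in>UNIV. x m i)"
        by (simp add: R x_def sum_distrib_left[symmetric] j)
      also have "\<dots> = (\<Prod>i\<in>UNIV. 2 powr x m i)" by (simp add: powr_sum)
      also have "\<dots> \<le> (\<Prod>i\<in>UNIV. 2 * real (E m i))" using twoE by (intro prod_mono) auto
      finally show ?thesis by (simp add: prod.distrib)
    qed
    show "2 ^ m \<le> (2 * real (E m i)) powr t" for m i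
    proof -
      have "1 / t \<le> real L * j $ i" using Lj[of i] by simp
      then have "1 \<le> real L * j $ i * t" using t by (simp add: field_simps)
      then have "real m * 1 \<le> real m * (real L * j $ i * t)" by (intro mult_left_mono) auto
      then have "real m \<le> x m i * t" by (simp add: x_def mult.assoc)
      then have "2 powr real m \<le> 2 powr (x m i * t)" by (intro powr_mono) auto
      also have "\<dots> = (2 powr x m i) powr t" by (simp add: powr_powr)
      also have "\<dots> \<le> (2 * real (E m i)) powr t" using twoE t by (intro powr_mono2) auto
      finally show ?thesis by (simp add: powr_realpow)
    qed
  qed
qed

text \<open>The members of the cover become obstacles whose weight is at most
  \<open>2 * 8 ^ CARD('n)\<close> times their cost, and the grid is chosen for the exponent gap
  \<open>n - s\<close>.\<close>

lemma bad_point_outside_cover: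
  fixes \<theta> j :: "real ^ 'n" and U :: "nat \<Rightarrow> (real ^ 'n) set" and s :: real
  assumes j: "\<And>i. j $ i > 0" "(\<Sum>i\<in>UNIV. j $ i) = 1"
    and s: "0 < s" "s < real CARD('n)"
    and U: "\<And>k. bounded (U k)" "\<And>k. diameter (U k) \<le> 1"
    and small: "(\<Sum>k. ennreal (diam_power s (U k))) < ennreal (1 / (4 * 8 ^ CARD('n)))"
  obtains \<eta> where "\<eta> \<in> twisted_bad \<theta> j" "\<And>i. \<eta> \<in> coord_bad i" "\<And>k. \<eta> \<notin> U k"
proof (rule weighted_dyadic_grid[OF j diff_gt_0_iff_gt[THEN iffD2, OF s(2)], of "8 * (4 * real CARD('n) + 2)"])
  fix E D :: "nat \<Rightarrow> 'n \<Rightarrow> nat" and R d :: real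
  assume grid: "box_grid E D"
    and D_ge: "\<And>m i. 8 * (4 * real CARD('n) + 2) \<le> real (D m i)" and D_le: "\<And>m i. real (D m i) \<le> d"
    and R: "1 < R" and E_le: "\<And>m i. real (E m i) \<le> (R ^ m) powr (j $ i)"
    and vol: "\<And>m. R ^ m \<le> 2 ^ CARD('n) * (\<Prod>i\<in>UNIV. real (E m i))"
    and grow: "\<And>m i. 2 ^ m \<le> (2 * real (E m i)) powr (real CARD('n) - s)"
  define n where "n = real CARD('n)"
  have n: "1 \<le> n" by (simp add: n_def Suc_le_eq)
  \<comment> \<open>Costs below \<open>\<kappa>\<close>, plus corrections \<open>y k\<close> summing
    to \<open>\<kappa>\<close>, give total weight below
    \<open>2 * 8 ^ CARD('n) * (2 * \<kappa>) = 1\<close>.\<close>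
  define \<kappa> where "\<kappa> = 1 / (4 * 8 ^ CARD('n) :: real)"
  have \<kappa>: "0 < \<kappa>" by (simp add: \<kappa>_def)
  interpret box_grid E D by (rule grid)
  have D2: "2 \<le> D m i" for m i
  proof -
    have "2 \<le> real (D m i)" using D_ge[of m i] n by (simp add: n_def)
    then show ?thesis by linarith
  qed
  have d: "0 < d" using D_le[of 0 undefined] D2[of 0 undefined] by linarith
  define c where "c = 1 / (8 * (2 * n + 7))"
  have c: "0 < c" "c < 1" using n by (auto simp: c_def field_simps)
  define \<epsilon> where "\<epsilon> = 1 / (64 * d * n)"
  have \<epsilon>: "0 < \<epsilon>" "4 * d * \<epsilon> \<le> 1 / (16 * real CARD('n))"
    using d n by (auto simp: \<epsilon>_def n_def)
  define y where "y k = \<kappa> * (1 / 2) ^ Suc k" for k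
  have y: "0 < y k" for k using \<kappa> by (simp add: y_def)
  \<comment> \<open>Sets of diameter 0 are treated as sets of positive diameter with negligible cost.\<close>
  define r where "r k = (if 0 < diameter (U k) then diameter (U k) else min 1 (y k powr (1 / s)))" for k
  have r: "0 < r k" "r k \<le> 1" for k using U(2)[of k] y[of k] by (auto simp: r_def)
  have dp0: "0 \<le> diam_power s (U k)" for k by (simp add: diam_power_def)
  have r_cost: "r k powr s \<le> diam_power s (U k) + y k" for k
  proof (cases "0 < diameter (U k)")
    case True
    then have "U k \<noteq> {}" by auto
    then show ?thesis using True y[of k] s by (simp add: r_def diam_power_def)
  next
    case False
    then have "r k powr s \<le> (y k powr (1 / s)) powr s"
      using s y[of k] by (intro powr_mono2) (auto simp: r_def)
    also have "\<dots> = y k" using s y[of k] by (simp add: powr_powr)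
    finally show ?thesis using dp0[of k] by simp
  qed
  have close: "\<bar>x $ i - z $ i\<bar> \<le> r k" if "x \<in> U k" "z \<in> U k" for x z i k
  proof -
    have "\<bar>x $ i - z $ i\<bar> \<le> norm (x - z)" using component_le_norm_cart[of "x - z" i] by simp
    also have "\<dots> \<le> diameter (U k)"
      using diameter_bounded_bound[OF U(1) that] by (simp add: dist_norm)
    also have "\<dots> \<le> r k"
    proof (cases "0 < diameter (U k)")
      case False
      then show ?thesis using r(1)[of k] by linarith
    qed (simp add: r_def)
    finally show ?thesis .
  qed
  have "\<exists>m. finite {b. cell m b \<inter> U k \<noteq> {}} \<and>
      2 ^ m / ncells m * real (card {b. cell m b \<inter> U k \<noteq> {}}) \<le> 2 * 8 ^ CARD('n) * r k powr s" for k
    using obstacle_weight_bound[OF r(1) r(2) _ s(2) D2 grow close] s(1) by (metis less_imp_le)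
  then obtain lev where lev: "\<And>k. finite {b. cell (lev k) b \<inter> U k \<noteq> {}}"
    "\<And>k. 2 ^ lev k / ncells (lev k) * real (card {b. cell (lev k) b \<inter> U k \<noteq> {}}) \<le> 2 * 8 ^ CARD('n) * r k powr s"
    by metis
  have weight: "(\<Sum>k. ennreal (2 ^ lev k / ncells (lev k) * real (card {b. cell (lev k) b \<inter> U k \<noteq> {}}))) < 1"
  proof -
    let ?K = "2 * 8 ^ CARD('n) :: real"
    have "(\<Sum>k. ennreal (2 ^ lev k / ncells (lev k) * real (card {b. cell (lev k) b \<inter> U k \<noteq> {}})))
        \<le> (\<Sum>k. ennreal ?K * (ennreal (diam_power s (U k)) + ennreal (y k)))"
    proof (rule suminf_le)
      fix k
      have "2 ^ lev k / ncells (lev k) * real (card {b. cell (lev k) b \<inter> U k \<noteq> {}}) \<le> ?K * (diam_power s (U k) + y k)"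
        by (rule order_trans[OF lev(2) mult_left_mono[OF r_cost]]) simp
      then show "ennreal (2 ^ lev k / ncells (lev k) * real (card {b. cell (lev k) b \<inter> U k \<noteq> {}}))
          \<le> ennreal ?K * (ennreal (diam_power s (U k)) + ennreal (y k))"
        using dp0[of k] y[of k] by (simp add: ennreal_leI ennreal_mult[symmetric] ennreal_plus[symmetric] del: ennreal_plus)
    qed auto
    also have "\<dots> = ennreal ?K * ((\<Sum>k. ennreal (diam_power s (U k))) + (\<Sum>k. ennreal (y k)))"
      by (simp add: suminf_add[symmetric])
    also have "(\<Sum>k. ennreal (y k)) = ennreal \<kappa>"
      using y sums_mult[OF power_half_series, of \<kappa>]
      by (intro suminf_ennreal_eq) (auto simp: y_def less_imp_le)
    also have "ennreal ?K * ((\<Sum>k. ennreal (diam_power s (U k))) + ennreal \<kappa>) < ennreal ?K * (ennreal \<kappa> + ennreal \<kappa>)"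
      using small by (intro ennreal_mult_strict_left_mono) (auto simp: \<kappa>_def)
    also have "\<dots> = 1" using \<kappa> by (simp add: ennreal_mult[symmetric] ennreal_plus[symmetric] del: ennreal_plus) (simp add: \<kappa>_def)
    finally show ?thesis .
  qed
  obtain v where v: "\<And>\<eta> \<delta> m w. (\<And>m. v m \<in> form_box c (Suc m) - form_box c m \<Longrightarrow> \<delta> \<le> dist_int (ldot (v m) \<eta>)) \<Longrightarrow>
      w \<in> form_box c m \<Longrightarrow>
      \<exists>u\<in>form_box c m. dist_int (ldot u \<theta>) \<le> dist_int (ldot w \<theta>) \<and> \<delta> \<le> dist_int (ldot u \<eta>)"
    using record_forms[of c \<theta>] c by (metis less_imp_le)
  obtain \<eta> where \<eta>: "\<And>k. \<eta> \<notin> U k"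
    "\<And>m. v m \<in> form_box c (Suc m) - form_box c m \<Longrightarrow> c\<^sup>2 \<le> dist_int (ldot (v m) \<eta>)"
    "\<And>m i q p. 0 < q \<Longrightarrow> 4 * of_int q ^ 2 < real (E m i) \<Longrightarrow> real (E m i) \<le> 4 * d * of_int q ^ 2
      \<Longrightarrow> \<epsilon> / of_int q ^ 2 \<le> \<bar>\<eta> $ i - of_int p / of_int q\<bar>"
    using point_avoiding_obstacles[OF c(1) _ D_ge \<epsilon> d lev(1) weight, of v]
    by (auto simp: c_def n_def)
  show thesis
  proof (rule that[OF _ _ \<eta>(1)])
    show "\<eta> \<in> coord_bad i" for i
      by (rule coord_badI[OF D2 D_le \<epsilon>(1) \<eta>(3)])
    have j1: "j $ i \<le> 1" for i
      using member_le_sum[of i UNIV "\<lambda>i. j $ i"] j by (simp add: less_imp_le)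
    show "\<eta> \<in> twisted_bad \<theta> j"
      by (rule twisted_badI[OF c(1) less_imp_le[OF c(2)] R j(1) j1 E_le vol[folded ncells_def] v[OF \<eta>(2)]])
  qed
qed

text \<open>The cube of half-side \<open>N\<close> splits into \<open>(2 * N * M) ^ n\<close> cubes
  of side \<open>1 / M\<close>, of total cost at most a constant times
  \<open>M powr (n - s)\<close>, which tends to 0. Choosing \<open>M\<close> separately for each
  \<open>N\<close> makes the costs summable to at most \<open>\<epsilon>\<close>.\<close>

lemma hausdorff_measure_above_dimension:
  fixes A :: "(real ^ 'n) set"
  assumes s: "real CARD('n) < s"
  shows "hausdorff_measure s A = 0"
proof -
  define n where "n = real CARD('n)"
  have n: "1 \<le> n" by (simp add: n_def Suc_le_eq)
  have zero: "hausdorff_premeasure s \<delta> A \<le> ennreal \<epsilon>" if \<delta>: "0 < \<delta>" and \<epsilon>: "0 < \<epsilon>" for \<delta> \<epsilon>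
  proof -
    define cube where "cube M b = cbox (\<chi> i. of_int (b i) / real M) (\<chi> i. (of_int (b i) + 1) / real M)"
      for M and b :: "'n \<Rightarrow> int"
    have diam: "diameter (cube M b) \<le> n / real M" if "0 < M" for M b
    proof (rule diameter_le)
      show "cube M b \<noteq> {} \<or> 0 \<le> n / real M" using n by simp
      fix x z assume xz: "x \<in> cube M b" "z \<in> cube M b"
      have "\<bar>(x - z) $ i\<bar> \<le> 1 / real M" for i
        using xz by (auto simp: cube_def mem_box_cart abs_le_iff add_divide_distrib dest!: spec[of _ i])
      then have "(\<Sum>i\<in>UNIV. \<bar>(x - z) $ i\<bar>) \<le> n * (1 / real M)"
        unfolding n_def by (intro sum_bounded_above)
      then show "norm (x - z) \<le> n / real M" using norm_le_l1_cart[of "x - z"] by simp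
    qed
    define Idx where "Idx N M = Pi UNIV (\<lambda>_::'n. {- int (N * M)..<int (N * M)})" for N M
    have finIdx: "finite (Idx N M)" for N M
      using finite_PiE[of UNIV "\<lambda>_::'n. {- int (N * M)..<int (N * M)}"] by (simp add: Idx_def PiE_def)
    have cardIdx: "real (card (Idx N M)) = (2 * real N) powr n * real M powr n" if "0 < M" "0 < N" for N M
      using card_PiE[of UNIV "\<lambda>_::'n. {- int (N * M)..<int (N * M)}"] that
      by (simp add: Idx_def PiE_def n_def powr_realpow power_mult_distrib nat_mult_distrib)
    have "\<exists>M. 0 < M \<and> n / real M \<le> \<delta> \<and> real (card (Idx N M)) * (n / real M) powr s \<le> \<epsilon> * (1 / 2) ^ Suc N"
      if N: "0 < N" for N
    proof -
      let ?K = "(2 * real N) powr n * n powr s"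
      have "((\<lambda>M. ?K * real M powr (n - s)) \<longlongrightarrow> ?K * 0) sequentially"
        using s by (intro tendsto_mult tendsto_const tendsto_neg_powr filterlim_real_sequentially) (simp add: n_def)
      then have "eventually (\<lambda>M. ?K * real M powr (n - s) < \<epsilon> * (1 / 2) ^ Suc N) sequentially"
        using \<epsilon> by (intro order_tendstoD) auto
      moreover have "eventually (\<lambda>M. n / \<delta> \<le> real M) sequentially"
        using filterlim_real_sequentially by (simp add: filterlim_at_top)
      ultimately have "eventually (\<lambda>M. 0 < M \<and> n / \<delta> \<le> real M \<and> ?K * real M powr (n - s) < \<epsilon> * (1 / 2) ^ Suc N) sequentially"
        using eventually_gt_at_top[of 0] by eventually_elim auto
      then obtain M where M: "0 < M" "n / \<delta> \<le> real M" "?K * real M powr (n - s) < \<epsilon> * (1 / 2) ^ Suc N"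
        using eventually_happens'[OF sequentially_bot] by blast
      have "real (card (Idx N M)) * (n / real M) powr s = ?K * real M powr (n - s)"
        using M(1) N n by (simp add: cardIdx powr_divide powr_diff)
      moreover have "n / real M \<le> \<delta>" using M \<delta> by (simp add: field_simps)
      ultimately show ?thesis using M by (intro exI[of _ M]) auto
    qed
    then obtain M where M: "\<And>N. 0 < N \<Longrightarrow> 0 < M N \<and> n / real (M N) \<le> \<delta> \<and>
        real (card (Idx N (M N))) * (n / real (M N)) powr s \<le> \<epsilon> * (1 / 2) ^ Suc N" by metis
    have "\<exists>W. (\<Union>b\<in>Idx N (M N). cube (M N) b) = (\<Union>k. W k) \<and> (\<forall>k. bounded (W k) \<and> diameter (W k) \<le> \<delta>)
        \<and> (\<Sum>k. ennreal (diam_power s (W k))) \<le> ennreal (\<epsilon> * (1 / 2) ^ Suc N)" for N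
    \<comment> \<open>\<open>Idx 0\<close> is empty, so \<open>N = 0\<close> needs no mesh and is
      covered by empty sets.\<close>
    proof (cases "N = 0")
      case True
      then show ?thesis
        using \<delta> by (intro exI[of _ "\<lambda>_. {}"]) (auto simp: Idx_def Pi_def diam_power_def)
    next
      case False
      then have MN: "0 < M N" "n / real (M N) \<le> \<delta>"
        "real (card (Idx N (M N))) * (n / real (M N)) powr s \<le> \<epsilon> * (1 / 2) ^ Suc N" using M[of N] by auto
      obtain h where h: "bij_betw h {0..<card (Idx N (M N))} (Idx N (M N))"
        using ex_bij_betw_nat_finite[OF finIdx] by blast
      define W where "W k = (if k < card (Idx N (M N)) then cube (M N) (h k) else {})" for k
      have "(\<Union>b\<in>Idx N (M N). cube (M N) b) = (\<Union>k\<in>{0..<card (Idx N (M N))}. cube (M N) (h k))"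
        using bij_betw_imp_surj_on[OF h] by (metis image_image)
      also have "\<dots> = (\<Union>k. W k)" by (auto simp: W_def split: if_splits)
      finally have 1: "(\<Union>b\<in>Idx N (M N). cube (M N) b) = (\<Union>k. W k)" .
      have 2: "bounded (W k) \<and> diameter (W k) \<le> \<delta>" for k
        using diam[OF MN(1), of "h k"] MN(2) \<delta> by (auto simp: W_def cube_def)
      have cost: "diam_power s (cube (M N) b) \<le> (n / real (M N)) powr s" for b
        using diam[OF MN(1), of b] s n
        by (auto simp: diam_power_def cube_def intro!: powr_mono2 diameter_ge_0)
      have "(\<Sum>k. ennreal (diam_power s (W k))) = (\<Sum>k<card (Idx N (M N)). ennreal (diam_power s (W k)))"
        by (rule suminf_finite) (auto simp: W_def diam_power_def)
      also have "\<dots> \<le> (\<Sum>k<card (Idx N (M N)). ennreal ((n / real (M N)) powr s))"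
        using cost by (intro sum_mono) (auto simp: W_def intro: ennreal_leI)
      also have "\<dots> = ennreal (real (card (Idx N (M N))) * (n / real (M N)) powr s)"
        by (simp add: ennreal_mult ennreal_of_nat_eq_real_of_nat)
      also have "\<dots> \<le> ennreal (\<epsilon> * (1 / 2) ^ Suc N)" using MN(3) by (rule ennreal_leI)
      finally show ?thesis using 1 2 by blast
    qed
    then obtain W where W: "\<And>N. (\<Union>b\<in>Idx N (M N). cube (M N) b) = (\<Union>k. W N k)"
      "\<And>N k. bounded (W N k) \<and> diameter (W N k) \<le> \<delta>"
      "\<And>N. (\<Sum>k. ennreal (diam_power s (W N k))) \<le> ennreal (\<epsilon> * (1 / 2) ^ Suc N)" by metis
    \<comment> \<open>The countably many countable covers are merged into one sequence through the
      pairing function.\<close>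
    define U where "U k = (case prod_decode k of (N, l) \<Rightarrow> W N l)" for k
    have covered: "\<exists>N k. x \<in> W N k" for x :: "real ^ 'n"
    proof -
      obtain N :: nat where N: "Max (range (\<lambda>i. \<bar>x $ i\<bar>)) < real N" using reals_Archimedean2 by blast
      have xN: "\<bar>x $ i\<bar> < real N" for i
        using N Max_ge[of "range (\<lambda>i. \<bar>x $ i\<bar>)" "\<bar>x $ i\<bar>"] by (simp add: le_less_trans)
      have "0 < N" using xN[of undefined] by (cases N) auto
      then have M0: "0 < real (M N)" using M by simp
      define b where "b i = \<lfloor>x $ i * real (M N)\<rfloor>" for i
      have "b i \<in> {- int (N * M N)..<int (N * M N)}" for i
      proof -
        have "\<bar>x $ i * real (M N)\<bar> < real N * real (M N)"
          using xN[of i] M0 by (simp add: abs_mult)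
        then show ?thesis by (auto simp: b_def le_floor_iff floor_less_iff abs_less_iff)
      qed
      then have "b \<in> Idx N (M N)" by (simp add: Idx_def)
      moreover have "x \<in> cube (M N) b"
        using M0 by (auto simp: cube_def mem_box_cart b_def pos_divide_le_eq pos_le_divide_eq less_imp_le)
      ultimately have "x \<in> (\<Union>k. W N k)" using W(1)[of N] by blast
      then show ?thesis by blast
    qed
    have "A \<subseteq> (\<Union>k. U k)"
    proof
      fix x :: "real ^ 'n"
      obtain N k where "x \<in> W N k" using covered by blast
      then have "x \<in> U (prod_encode (N, k))" by (simp add: U_def)
      then show "x \<in> (\<Union>k. U k)" by blast
    qed
    then have "U \<in> delta_covers \<delta> A"
      using W(2) by (auto simp: delta_covers_def U_def split: prod.split)
    then have "hausdorff_premeasure s \<delta> A \<le> (\<Sum>k. ennreal (diam_power s (U k)))"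
      unfolding hausdorff_premeasure_def by (rule INF_lower)
    also have "\<dots> = (\<Sum>k. (\<lambda>(N, l). ennreal (diam_power s (W N l))) (prod_decode k))"
      by (simp add: U_def split_def)
    also have "\<dots> = (\<Sum>N. \<Sum>l. ennreal (diam_power s (W N l)))"
      by (rule suminf_ennreal_2dimen) simp
    also have "\<dots> \<le> (\<Sum>N. ennreal (\<epsilon> * (1 / 2) ^ Suc N))" by (intro suminf_le W(3)) auto
    also have "\<dots> = ennreal \<epsilon>"
      using \<epsilon> sums_mult[OF power_half_series, of \<epsilon>] by (intro suminf_ennreal_eq) auto
    finally show ?thesis .
  qed
  have "hausdorff_premeasure s \<delta> A = 0" if "0 < \<delta>" for \<delta>
  proof -
    have "hausdorff_premeasure s \<delta> A \<le> 0"
      by (rule ennreal_le_epsilon) (use zero[OF that] in auto)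
    then show ?thesis by simp
  qed
  then show ?thesis by (simp add: hausdorff_measure_def)
qed

section \<open>Both bounds for the Hausdorff dimension of the intersection\<close>

theorem theorem1:
  fixes \<theta> j :: "real ^ 'n"
  assumes "\<And>i. j $ i > 0"
    and "(\<Sum>i\<in>UNIV. j $ i) = 1"
  shows "hausdorff_dim (twisted_bad \<theta> j \<inter> (\<Inter>i. coord_bad i)) = of_nat CARD('n)"
proof (rule antisym)
  let ?A = "twisted_bad \<theta> j \<inter> (\<Inter>i. coord_bad i)"
  define n where "n = real CARD('n)"
  have n: "1 \<le> n" by (simp add: n_def Suc_le_eq)
  have n_eq: "(of_nat CARD('n) :: ennreal) = ennreal n"
    by (simp add: n_def ennreal_of_nat_eq_real_of_nat)
  show "hausdorff_dim ?A \<le> of_nat CARD('n)"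
  proof (rule ennreal_le_epsilon)
    fix e :: real assume e: "0 < e"
    have "hausdorff_dim ?A \<le> ennreal (n + e)"
      unfolding hausdorff_dim_def
      using e n hausdorff_measure_above_dimension[where 'n = 'n, of "n + e"]
      by (intro INF_lower) (auto simp: n_def)
    then show "hausdorff_dim ?A \<le> of_nat CARD('n) + ennreal e"
      using e n by (simp add: n_eq)
  qed
  show "of_nat CARD('n) \<le> hausdorff_dim ?A"
    unfolding hausdorff_dim_def n_eq
  proof (intro INF_greatest ennreal_leI, clarify)
    fix s assume s: "0 \<le> s" "hausdorff_measure s ?A = 0"
    show "n \<le> s"
    proof (rule ccontr)
      assume "\<not> n \<le> s"
      \<comment> \<open>A positive exponent is needed to neglect sets of diameter 0, so
        \<open>s = 0\<close> is replaced by \<open>n / 2\<close>. As the diameters are at most 1,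
        the larger exponent does not increase any cost.\<close>
      define s' where "s' = (if s = 0 then n / 2 else s)"
      have s': "0 < s'" "s' < n" "s \<le> s'" using \<open>\<not> n \<le> s\<close> s n by (auto simp: s'_def)
      \<comment> \<open>Scale 1 is enough: a vanishing measure already gives covers by sets of
        diameter at most 1 with arbitrarily small cost.\<close>
      have "hausdorff_premeasure s 1 ?A \<le> hausdorff_measure s ?A"
        unfolding hausdorff_measure_def by (intro SUP_upper) simp
      then have "hausdorff_premeasure s 1 ?A < ennreal (1 / (4 * 8 ^ CARD('n)))"
        using s(2) by simp
      then obtain U where U: "U \<in> delta_covers 1 ?A"
        "(\<Sum>k. ennreal (diam_power s (U k))) < ennreal (1 / (4 * 8 ^ CARD('n)))"
        unfolding hausdorff_premeasure_def by (auto simp: INF_less_iff)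
      have cover: "?A \<subseteq> (\<Union>k. U k)" and bd: "bounded (U k)" and dm: "diameter (U k) \<le> 1" for k
        using U(1) by (auto simp: delta_covers_def)
      have "diam_power s' (U k) \<le> diam_power s (U k)" for k
        using dm[of k] diameter_ge_0[OF bd[of k]] s'(1) by (auto simp: diam_power_def s'_def powr_le1)
      then have "(\<Sum>k. ennreal (diam_power s' (U k))) \<le> (\<Sum>k. ennreal (diam_power s (U k)))"
        by (intro suminf_le ennreal_leI) auto
      then have "(\<Sum>k. ennreal (diam_power s' (U k))) < ennreal (1 / (4 * 8 ^ CARD('n)))"
        using U(2) by (rule le_less_trans)
      then obtain \<eta> where "\<eta> \<in> twisted_bad \<theta> j" "\<And>i. \<eta> \<in> coord_bad i" "\<And>k. \<eta> \<notin> U k"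
        using bad_point_outside_cover[where U = U and \<theta> = \<theta>, OF assms s'(1) s'(2)[unfolded n_def] bd dm] by blast
      then show False using cover by blast
    qed
  qed
qed

end
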